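(* Let $d\ge4$ and let $\mathcal{D}_0$ be the massless Dirac operator on the round sphere $\mathbb{S}^d$. Then the Strichartz estimate $$\|e^{it\mathcal{D}_0}u_0\|_{L^p(I,L^q(\mathbb{S}^d))}\le C(I)\,\|u_0\|_{H^{\gamma^{\rm W}_{p,q}}(\mathbb{S}^d)},\qquad \gamma^{\rm W}_{p,q}=d\left(\tfrac12-\tfrac1q\right)-\tfrac1p,$$ is sharp for the pair $(p,q)=\left(2,\frac{2(d-1)}{d-3}\right)$, for which $\gamma^{\rm W}_{p,q}=\frac{d+1}{2(d-1)}$. That is, for every bounded interval $I\subset\mathbb{R}$ of positive length and every $s<\frac{d+1}{2(d-1)}$, there is no constant $C$ such that $$\|e^{it\mathcal{D}_0}u_0\|_{L^2\left(I,L^{\frac{2(d-1)}{d-3}}(\mathbb{S}^d)\right)}\le C\,\|u_0\|_{H^{s}(\mathbb{S}^d)}$$ holds for all smooth spinors $u_0$ on $\mathbb{S}^d$.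
   Context: $\mathbb{S}^d$ is the unit $d$-sphere with its standard round metric and spin structure; $\mathcal{D}_0$ is its standard self-adjoint (massless) Dirac operator acting on spinors, locally $\mathcal{D}_0=-i\gamma^ae^i_{\;a}D_i$ with Hermitian matrices satisfying $\gamma^i\gamma^j+\gamma^j\gamma^i=2\delta^{ij}$, $e^i_{\;a}$ a local orthonormal frame and $D_i$ the spin connection. Its eigenvalues are $\pm(n+\frac d2)$, $n=0,1,2,\dots$. $H^s(\mathbb{S}^d)$ is the $L^2$-based Sobolev space of order $s$ of spinors; $L^p(I,L^q)$ means $L^p$ in time $t\in I$ and $L^q$ in space. *)

theory Defs
  imports "HOL-Analysis.Analysis"
begin

section \<open>The round sphere in two stereographic charts\<close>

text \<open>
  The dimension is \<open>d = CARD('d)\<close>. The sphere is the unit sphere of \<open>real ^ 'd \<times> real\<close>, covered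
  by two stereographic charts, each defined on all of \<open>real ^ 'd\<close>; the chart labelled by a pole is
  centred at that pole and omits the opposite one. The southern chart is composed with the
  reflection of the coordinate \<open>k\<close>, so that the two charts induce the same orientation.
\<close>

datatype pole = North | South

definition reflect :: "'d::finite \<Rightarrow> real ^ 'd \<Rightarrow> real ^ 'd" where
  "reflect k x = (\<chi> i. if i = k then - x $ i else x $ i)"

fun chart :: "'d::finite \<Rightarrow> pole \<Rightarrow> real ^ 'd \<Rightarrow> (real ^ 'd) \<times> real" where
  "chart k North x = ((2 / (1 + x \<bullet> x)) *\<^sub>R x, (1 - x \<bullet> x) / (1 + x \<bullet> x))"
| "chart k South x = ((2 / (1 + x \<bullet> x)) *\<^sub>R reflect k x, - ((1 - x \<bullet> x) / (1 + x \<bullet> x)))"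

definition transition :: "'d::finite \<Rightarrow> real ^ 'd \<Rightarrow> real ^ 'd" where
  "transition k x = (1 / (x \<bullet> x)) *\<^sub>R reflect k x"

lemma chart_transition:
  fixes x :: "real ^ 'd::finite"
  assumes "x \<noteq> 0"
  shows "chart k South (transition k x) = chart k North x"
proof -
  have r: "reflect k v \<bullet> reflect k v = v \<bullet> v" for v :: "real ^ 'd"
    unfolding inner_vec_def reflect_def by (rule sum.cong) auto
  have rr: "reflect k (c *\<^sub>R reflect k v) = c *\<^sub>R v" for v :: "real ^ 'd" and c
    by (simp add: reflect_def vec_eq_iff)
  have p: "x \<bullet> x > 0" using assms by simp
  have s: "transition k x \<bullet> transition k x = 1 / (x \<bullet> x)"
    using p by (simp add: transition_def r)
  have "1 + 1 / (x \<bullet> x) = (1 + x \<bullet> x) / (x \<bullet> x)" "1 - 1 / (x \<bullet> x) = - (1 - x \<bullet> x) / (x \<bullet> x)"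
    using p by (simp_all add: field_simps)
  then show ?thesis
    using p by (simp add: s) (simp add: transition_def rr minus_divide_left)
qed

definition pderiv_vec :: "'d::finite \<Rightarrow> (real ^ 'd \<Rightarrow> 'b::real_normed_vector) \<Rightarrow> real ^ 'd \<Rightarrow> 'b" where
  "pderiv_vec i f x = frechet_derivative f (at x) (axis i 1)"

definition round_metric :: "'d::finite \<Rightarrow> pole \<Rightarrow> real ^ 'd \<Rightarrow> real ^ 'd ^ 'd" where
  "round_metric k c x = (\<chi> i j. pderiv_vec i (chart k c) x \<bullet> pderiv_vec j (chart k c) x)"

text \<open>\<open>frame a x $ i\<close> is the component $e^i_{\;a}$, the same in both charts.\<close>

definition frame :: "'d::finite \<Rightarrow> real ^ 'd \<Rightarrow> real ^ 'd" where
  "frame a x = ((1 + x \<bullet> x) / 2) *\<^sub>R axis a 1"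

definition christoffel :: "'d::finite \<Rightarrow> pole \<Rightarrow> 'd \<Rightarrow> 'd \<Rightarrow> 'd \<Rightarrow> real ^ 'd \<Rightarrow> real" where
  "christoffel k c j i m x =
     (1/2) * (\<Sum>l\<in>UNIV. matrix_inv (round_metric k c x) $ j $ l *
        (pderiv_vec i (\<lambda>y. round_metric k c y $ l $ m) x
         + pderiv_vec m (\<lambda>y. round_metric k c y $ l $ i) x
         - pderiv_vec l (\<lambda>y. round_metric k c y $ i $ m) x))"

lemma round_metric_eq:
  "round_metric k c x $ i $ j = (if i = j then 4 / (1 + x \<bullet> x)\<^sup>2 else 0)"
  for x :: "real ^ 'd::finite"
proof -
  let ?s = "1 + x \<bullet> x"
  have s0: "?s \<noteq> 0" by (smt (verit) inner_ge_zero)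
  have r_lin: "bounded_linear (reflect k)"
    unfolding reflect_def
    by (intro linear_conv_bounded_linear[THEN iffD1] linearI) (auto simp: vec_eq_iff)
  have r_in: "reflect k u \<bullet> reflect k v = u \<bullet> v" for u v :: "real ^ 'd"
    unfolding inner_vec_def reflect_def by (rule sum.cong) auto
  define dN :: "real ^ 'd \<Rightarrow> (real ^ 'd) \<times> real" where
    "dN h = ((2 / ?s) *\<^sub>R h - (4 * (x \<bullet> h) / ?s\<^sup>2) *\<^sub>R x, - 4 * (x \<bullet> h) / ?s\<^sup>2)" for h
  define dS :: "real ^ 'd \<Rightarrow> (real ^ 'd) \<times> real" where
    "dS h = (reflect k (fst (dN h)), - snd (dN h))" for h
  have w: "((\<lambda>y. inverse (1 + y \<bullet> y)) has_derivative (\<lambda>h. - 2 * (x \<bullet> h) / ?s\<^sup>2)) (at x)"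
    by (rule derivative_eq_intros refl s0 ext
        | simp add: inner_commute power2_eq_square divide_simps)+
  have CN: "chart k North
      = (\<lambda>y. ((2 * inverse (1 + y \<bullet> y)) *\<^sub>R y, 2 * inverse (1 + y \<bullet> y) - 1))"
  proof
    fix y :: "real ^ 'd"
    have "1 + y \<bullet> y \<noteq> 0" by (smt (verit) inner_ge_zero)
    then show "chart k North y = ((2 * inverse (1 + y \<bullet> y)) *\<^sub>R y, 2 * inverse (1 + y \<bullet> y) - 1)"
      by (simp add: divide_simps)
  qed
  have N: "(chart k North has_derivative dN) (at x)"
    unfolding CN dN_def
    by (rule derivative_eq_intros w refl ext | simp add: divide_inverse)+
  have SN: "chart k South = (\<lambda>y. (reflect k (fst (chart k North y)), - snd (chart k North y)))"
    by (rule ext) (simp add: reflect_def vec_eq_iff)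
  have S: "(chart k South has_derivative dS) (at x)"
    unfolding SN dS_def
    by (intro has_derivative_Pair has_derivative_minus bounded_linear.has_derivative[OF r_lin]
        has_derivative_fst has_derivative_snd N)
  have dN: "dN u \<bullet> dN v = 4 / ?s\<^sup>2 * (u \<bullet> v)" for u v
  proof -
    define r where "r = 1 / ?s"
    have r: "r * ?s = 1" using s0 by (simp add: r_def)
    have dN_r: "dN h = ((2 * r) *\<^sub>R h - (4 * r\<^sup>2 * (x \<bullet> h)) *\<^sub>R x, - (4 * r\<^sup>2 * (x \<bullet> h)))" for h
      by (simp add: dN_def r_def power_divide)
    have "dN u \<bullet> dN v = 4 * r\<^sup>2 * (u \<bullet> v)
        + 16 * r ^ 3 * (x \<bullet> u) * (x \<bullet> v) * (r * ?s - 1)"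
      unfolding dN_r inner_Pair inner_diff_left inner_diff_right inner_scaleR_left
        inner_scaleR_right inner_commute[of u x] inner_real_def
      by algebra
    then show ?thesis unfolding r by (simp add: r_def power_divide)
  qed
  have dS: "dS u \<bullet> dS v = dN u \<bullet> dN v" for u v
    by (simp add: dS_def r_in inner_prod_def)
  show ?thesis
    using frechet_derivative_at[OF N, symmetric] frechet_derivative_at[OF S, symmetric]
    by (cases c) (auto simp: round_metric_def pderiv_vec_def dN dS inner_axis_axis)
qed

lemma frame_orthonormal:
  "(\<Sum>i\<in>UNIV. \<Sum>j\<in>UNIV. round_metric k c x $ i $ j * frame a x $ i * frame b x $ j)
     = (if a = b then 1 else 0)"
  for x :: "real ^ 'd::finite"
proof -
  have s0: "1 + x \<bullet> x \<noteq> 0" by (smt (verit) inner_ge_zero)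
  have f: "frame e x $ i = (if i = e then (1 + x \<bullet> x) / 2 else 0)" for e i
    by (simp add: frame_def axis_def)
  have "(\<Sum>j\<in>UNIV. round_metric k c x $ i $ j * frame a x $ i * frame b x $ j)
      = (if i = a then (if a = b then 1 else 0) else 0)" for i
  proof -
    have "(\<Sum>j\<in>UNIV. round_metric k c x $ i $ j * frame a x $ i * frame b x $ j)
        = (\<Sum>j\<in>UNIV. if j = b then round_metric k c x $ i $ b * frame a x $ i * frame b x $ b else 0)"
      by (rule sum.cong) (auto simp: f)
    also have "\<dots> = round_metric k c x $ i $ b * frame a x $ i * frame b x $ b"
      by simp
    also have "\<dots> = (if i = a then (if a = b then 1 else 0) else 0)"
      using s0 by (auto simp: f round_metric_eq power2_eq_square divide_simps)
    finally show ?thesis .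
  qed
  then show ?thesis by simp
qed

text \<open>\<open>spin_connection k c i a b x\<close> is $\omega_{i\,ab} = g(e_a, \nabla_i e_b)$.\<close>

definition spin_connection :: "'d::finite \<Rightarrow> pole \<Rightarrow> 'd \<Rightarrow> 'd \<Rightarrow> 'd \<Rightarrow> real ^ 'd \<Rightarrow> real" where
  "spin_connection k c i a b x =
     (\<Sum>j\<in>UNIV. \<Sum>l\<in>UNIV. round_metric k c x $ j $ l * frame a x $ j *
        (pderiv_vec i (\<lambda>y. frame b y $ l) x
         + (\<Sum>m\<in>UNIV. christoffel k c l i m x * frame b x $ m)))"


section \<open>Spinors and the Dirac operator\<close>

definition gamma_matrices :: "('d::finite \<Rightarrow> complex ^ 'n ^ 'n::finite) \<Rightarrow> bool" where
  "gamma_matrices \<gamma> \<longleftrightarrow>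
     (\<forall>a i j. \<gamma> a $ i $ j = cnj (\<gamma> a $ j $ i)) \<and>
     (\<forall>a b. \<gamma> a ** \<gamma> b + \<gamma> b ** \<gamma> a = (if a = b then mat 2 else 0))"

definition clifford :: "('d::finite \<Rightarrow> complex ^ 'n ^ 'n::finite) \<Rightarrow> real ^ 'd \<Rightarrow> complex ^ 'n ^ 'n" where
  "clifford \<gamma> v = (\<Sum>a\<in>UNIV. (v $ a) *\<^sub>R \<gamma> a)"

primrec C_k :: "nat \<Rightarrow> (real ^ 'd::finite \<Rightarrow> 'b::real_normed_vector) \<Rightarrow> bool" where
  "C_k 0 f \<longleftrightarrow> continuous_on UNIV f"
| "C_k (Suc m) f \<longleftrightarrow> (\<forall>x. f differentiable (at x)) \<and> (\<forall>i. C_k m (pderiv_vec i f))"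

definition smooth :: "(real ^ 'd::finite \<Rightarrow> 'b::real_normed_vector) \<Rightarrow> bool" where
  "smooth f \<longleftrightarrow> (\<forall>m. C_k m f)"

text \<open>
  A spinor is given by its components in the two charts with respect to the frames above. On the
  overlap the frames differ by the rotation \<open>v \<mapsto> reflect k (v - 2 (v \<bullet> n) n)\<close> with
  \<open>n = x / norm x\<close>, and \<open>\<gamma> k ** clifford \<gamma> n\<close> is a lift of it to the spin group: conjugation by
  this matrix takes \<open>clifford \<gamma> v\<close> to \<open>clifford \<gamma> (reflect k (v - 2 (v \<bullet> n) n))\<close>. The other lift
  differs by a global sign and gives an isomorphic bundle.
\<close>

type_synonym ('d, 'n) spinor = "pole \<Rightarrow> real ^ 'd \<Rightarrow> complex ^ 'n"

definition smooth_spinors ::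
  "('d::finite \<Rightarrow> complex ^ 'n ^ 'n::finite) \<Rightarrow> 'd \<Rightarrow> ('d, 'n) spinor set" where
  "smooth_spinors \<gamma> k =
     {u. smooth (u North) \<and> smooth (u South) \<and>
         (\<forall>x. x \<noteq> 0 \<longrightarrow>
            u South (transition k x) = (\<gamma> k ** clifford \<gamma> (sgn x)) *v u North x)}"

definition spin_deriv ::
  "('d::finite \<Rightarrow> complex ^ 'n ^ 'n::finite) \<Rightarrow> 'd \<Rightarrow> 'd \<Rightarrow> ('d, 'n) spinor \<Rightarrow> ('d, 'n) spinor" where
  "spin_deriv \<gamma> k i u = (\<lambda>c x.
     pderiv_vec i (u c) x
     + (1/8) *\<^sub>R (\<Sum>a\<in>UNIV. \<Sum>b\<in>UNIV. spin_connection k c i a b x *\<^sub>R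
         ((\<gamma> a ** \<gamma> b - \<gamma> b ** \<gamma> a) *v u c x)))"

definition dirac ::
  "('d::finite \<Rightarrow> complex ^ 'n ^ 'n::finite) \<Rightarrow> 'd \<Rightarrow> ('d, 'n) spinor \<Rightarrow> ('d, 'n) spinor" where
  "dirac \<gamma> k u = (\<lambda>c x.
     (- \<i>) *s (\<Sum>a\<in>UNIV. \<Sum>i\<in>UNIV. (frame a x $ i) *\<^sub>R (\<gamma> a *v spin_deriv \<gamma> k i u c x)))"


section \<open>Lebesgue norms\<close>

text \<open>Integrals over the sphere are taken in the northern chart, which omits a single point.\<close>

definition sphere_integral ::
  "'d::finite \<Rightarrow> (real ^ 'd \<Rightarrow> 'b::{banach, second_countable_topology}) \<Rightarrow> 'b" where
  "sphere_integral k f = (LINT x|lborel. sqrt (det (round_metric k North x)) *\<^sub>R f x)"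

definition spinor_inner ::
  "'d::finite \<Rightarrow> ('d, 'n::finite) spinor \<Rightarrow> ('d, 'n) spinor \<Rightarrow> complex" where
  "spinor_inner k u v =
     sphere_integral k (\<lambda>x. \<Sum>i\<in>UNIV. cnj (u North x $ i) * v North x $ i)"

definition Lp_norm :: "'d::finite \<Rightarrow> real \<Rightarrow> ('d, 'n::finite) spinor \<Rightarrow> real" where
  "Lp_norm k q u = sphere_integral k (\<lambda>x. norm (u North x) powr q) powr (1 / q)"

definition LpLq_norm ::
  "'d::finite \<Rightarrow> real \<Rightarrow> real \<Rightarrow> real set \<Rightarrow> (real \<Rightarrow> ('d, 'n::finite) spinor) \<Rightarrow> real" where
  "LpLq_norm k p q I v = (LINT t:I|lborel. Lp_norm k q (v t) powr p) powr (1 / p)"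


section \<open>Functional calculus of the Dirac operator\<close>

definition eigenspinors ::
  "('d::finite \<Rightarrow> complex ^ 'n ^ 'n::finite) \<Rightarrow> 'd \<Rightarrow> real \<Rightarrow> ('d, 'n) spinor set" where
  "eigenspinors \<gamma> k l =
     {u \<in> smooth_spinors \<gamma> k. dirac \<gamma> k u = (\<lambda>c x. complex_of_real l *s u c x)}"

text \<open>Orthogonal projection onto the (finite-dimensional) eigenspace; zero off the spectrum.\<close>

definition eigenprojection ::
  "('d::finite \<Rightarrow> complex ^ 'n ^ 'n::finite) \<Rightarrow> 'd \<Rightarrow> real \<Rightarrow> ('d, 'n) spinor \<Rightarrow> ('d, 'n) spinor" where
  "eigenprojection \<gamma> k l u =
     (THE v. v \<in> eigenspinors \<gamma> k l \<and>
        (\<forall>w\<in>eigenspinors \<gamma> k l. spinor_inner k w (\<lambda>c x. u c x - v c x) = 0))"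

text \<open>
  $F(\mathcal D_0)u = \sum_\lambda F(\lambda) P_\lambda u$ with convergence in $L^2$. For smooth \<open>u\<close> and
  \<open>F\<close> of polynomial growth the sum is represented by a unique smooth spinor.
\<close>

definition dirac_calculus ::
  "('d::finite \<Rightarrow> complex ^ 'n ^ 'n::finite) \<Rightarrow> 'd \<Rightarrow> (real \<Rightarrow> complex) \<Rightarrow>
   ('d, 'n) spinor \<Rightarrow> ('d, 'n) spinor" where
  "dirac_calculus \<gamma> k F u =
     (THE v. v \<in> smooth_spinors \<gamma> k \<and>
        ((\<lambda>A. Lp_norm k 2 (\<lambda>c x. v c x - (\<Sum>l\<in>A. F l *s eigenprojection \<gamma> k l u c x)))
           \<longlongrightarrow> 0) (finite_subsets_at_top UNIV))"

definition dirac_propagator ::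
  "('d::finite \<Rightarrow> complex ^ 'n ^ 'n::finite) \<Rightarrow> 'd \<Rightarrow> real \<Rightarrow> ('d, 'n) spinor \<Rightarrow> ('d, 'n) spinor" where
  "dirac_propagator \<gamma> k t = dirac_calculus \<gamma> k (\<lambda>l. exp (\<i> * complex_of_real (t * l)))"

text \<open>The Sobolev norm is $\|(1 + \mathcal D_0^2)^{s/2} u\|_{L^2}$.\<close>

definition sobolev_norm ::
  "('d::finite \<Rightarrow> complex ^ 'n ^ 'n::finite) \<Rightarrow> 'd \<Rightarrow> real \<Rightarrow> ('d, 'n) spinor \<Rightarrow> real" where
  "sobolev_norm \<gamma> k s u =
     Lp_norm k 2 (dirac_calculus \<gamma> k (\<lambda>l. complex_of_real ((1 + l\<^sup>2) powr (s / 2))) u)"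

definition strichartz_exponent :: "real \<Rightarrow> real \<Rightarrow> real \<Rightarrow> real" where
  "strichartz_exponent d p q = d * (1/2 - 1/q) - 1/p"

end

theory Submission
  imports Defs
begin

text \<open>
  The estimate is tested on eigenspinors. If \<open>u\<close> is an eigenspinor for the eigenvalue \<open>l\<close>, the
  functional calculus acts on it by scalars (\<open>dirac_calculus_zonal\<close>): the flow multiplies \<open>u\<close> by a
  phase, and the Sobolev norm is \<open>(1 + l\<^sup>2) powr (s / 2)\<close> times the \<open>L\<^sup>2\<close> norm. The space-time
  estimate thus becomes a bound for the quotient of the \<open>L\<^sup>q\<close> and \<open>L\<^sup>2\<close> norms of \<open>u\<close>. For the
  given pair of exponents this quotient grows at least like \<open>l\<close> to the power \<open>(d + 1) / (2 * (d - 1))\<close> on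
  zonal eigenspinors, which concentrate at a pole at the scale \<open>1 / l\<close>.

  Zonal eigenspinors. In stereographic coordinates the Dirac operator is the flat one up to
  conformal factors (\<open>dirac_eq\<close>). The ansatz of a radial function times a constant spinor plus another
  radial function times \<open>\<i>\<close> times Clifford multiplication by \<open>x\<close> turns the eigenvalue equation into
  two first-order equations in the height \<open>z\<close>. When the second function is the reflection
  \<open>z \<mapsto> p (- z)\<close> of the first, the two collapse into one equation for a polynomial \<open>p\<close>
  (\<open>zonal_profile\<close>), whose coefficients obey a two-term recursion that terminates when \<open>l\<close> is
  \<open>n + d / 2\<close> with \<open>n\<close> even.

  Size of the profile. The squared norm of the spinor is half of \<open>zonal_energy p\<close>. Normalised by
  \<open>p 1 = 1\<close>, the profile stays above \<open>1 / 2\<close> within distance \<open>c / l\<close> of the pole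
  (\<open>zonal_profile_near_pole\<close>); this bounds the \<open>L\<^sup>q\<close> norm from below by a multiple of
  \<open>l powr (- d / q)\<close>. Farther away a modified energy that is almost monotone gives decay like
  \<open>(l * sin \<theta>)\<close> to the power \<open>- (d - 1)\<close> at polar angle \<open>\<theta>\<close> (\<open>zonal_energy_decay\<close>), so that
  the \<open>L\<^sup>2\<close> norm is at most a multiple of \<open>l powr (- (d - 1) / 2)\<close>. The quotient of the two bounds is
  the claimed power of \<open>l\<close>.

  The functional calculus. Its value on \<open>u\<close> is known once the projections of \<open>u\<close> to all other
  eigenspaces vanish, that is, once eigenspinors for different eigenvalues are orthogonal
  (\<open>eigenspinors_orthogonal\<close>). This is the symmetry of the Dirac operator: the difference of the two
  sides is the integral of a divergence over the chart. That integral vanishes because the vector field and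
  its divergence are integrable (\<open>integral_divergence_eq_0\<close>).
\<close>


section \<open>Stereographic coordinates\<close>

text \<open>The conformal factor of the round metric, which is the sine of the polar angle divided by \<open>norm x\<close>.\<close>

definition conf :: "'a::real_inner \<Rightarrow> real" where
  "conf x = 2 / (1 + x \<bullet> x)"

lemma conf_pos [simp]: "conf x > 0"
  by (simp add: conf_def add_pos_nonneg)

lemma conf_neq_0 [simp]: "conf x \<noteq> 0"
  using conf_pos [of x] by linarith

lemma conf_has_derivative [derivative_intros]:
  "(conf has_derivative (\<lambda>h. - (conf x)\<^sup>2 * (x \<bullet> h))) (at x)"
proof -
  have s0: "1 + x \<bullet> x \<noteq> 0" by (smt (verit) inner_ge_zero)
  show ?thesis
    unfolding conf_def
    by (rule derivative_eq_intros refl s0 ext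
        | simp add: s0 inner_commute power2_eq_square divide_simps)+
qed

lemma pderiv_vec_eq: "(f has_derivative f') (at x) \<Longrightarrow> pderiv_vec i f x = f' (axis i 1)"
  unfolding pderiv_vec_def using frechet_derivative_at by metis

lemma round_metric_mat: "round_metric k c x = mat ((conf x)\<^sup>2)"
  by (simp add: vec_eq_iff round_metric_eq mat_def conf_def power_divide)

lemma sqrt_det_round_metric: "sqrt (det (round_metric k c (x :: real ^ 'd::finite))) = conf x ^ CARD('d)"
proof -
  have "det (round_metric k c x) = (\<Prod>i\<in>(UNIV::'d set). (conf x)\<^sup>2)"
    unfolding round_metric_mat by (subst det_diagonal) (simp_all add: mat_def)
  also have "\<dots> = (conf x ^ CARD('d))\<^sup>2"
    by (simp add: power_mult [symmetric] mult.commute)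
  finally show ?thesis by (simp add: less_imp_le)
qed

lemma matrix_inv_mat:
  assumes "c \<noteq> 0"
  shows "matrix_inv (mat c :: real ^ 'd ^ 'd::finite) = mat (1 / c)"
proof -
  have "mat a ** mat b = (mat (a * b) :: real ^ 'd ^ 'd)" for a b
    by (simp add: matrix_matrix_mult_def mat_def vec_eq_iff if_distrib [where f = "\<lambda>x. x * _"]
        if_distrib [where f = "\<lambda>x. _ * x"] cong: if_cong)
  then have 1: "mat c ** mat (1 / c) = (mat 1 :: real ^ 'd ^ 'd)" "mat (1 / c) ** mat c = (mat 1 :: real ^ 'd ^ 'd)"
    using assms by simp_all
  have 2: "B = mat (1 / c)" if "mat c ** B = mat 1" for B :: "real ^ 'd ^ 'd"
    using arg_cong [OF that, of "\<lambda>M. mat (1 / c) ** M"] by (simp add: matrix_mul_assoc 1)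
  show ?thesis
    unfolding matrix_inv_def
  proof (rule some_equality)
    show "mat c ** mat (1 / c) = (mat 1 :: real ^ 'd ^ 'd) \<and> mat (1 / c) ** mat c = (mat 1 :: real ^ 'd ^ 'd)"
      using 1 by (rule conjI)
  qed (erule conjE, erule 2)
qed

lemma pderiv_round_metric:
  "pderiv_vec i (\<lambda>y. round_metric k c y $ l $ m) x = (if l = m then - 2 * conf x ^ 3 * x $ i else 0)"
proof -
  have "((\<lambda>y. (conf y)\<^sup>2) has_derivative (\<lambda>h. - 2 * conf x ^ 3 * (x \<bullet> h))) (at x)"
    by (rule derivative_eq_intros refl ext | simp add: power2_eq_square power3_eq_cube)+
  from pderiv_vec_eq [OF this, of i]
  have "pderiv_vec i (\<lambda>y. (conf y)\<^sup>2) x = - 2 * conf x ^ 3 * x $ i"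
    by (simp add: inner_axis)
  moreover have "pderiv_vec i (\<lambda>y. 0 :: real) x = 0"
    by (subst pderiv_vec_eq [OF has_derivative_const]) simp
  ultimately show ?thesis by (auto simp: round_metric_mat mat_def)
qed

lemma christoffel_eq:
  "christoffel k c j i m x =
     conf x * ((if i = m then x $ j else 0) - (if j = m then x $ i else 0) - (if j = i then x $ m else 0))"
proof -
  have c0: "(conf x)\<^sup>2 \<noteq> 0"
    by simp
  have I: "matrix_inv (round_metric k c x) $ a $ b = (if a = b then 1 / (conf x)\<^sup>2 else 0)" for a b
    unfolding round_metric_mat matrix_inv_mat [OF c0] by (simp add: mat_def)
  have "christoffel k c j i m x = (1/2) * (\<Sum>l\<in>UNIV. if l = j then
      (1 / (conf x)\<^sup>2) * ((if j = m then - 2 * conf x ^ 3 * x $ i else 0) +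
        (if j = i then - 2 * conf x ^ 3 * x $ m else 0) - (if i = m then - 2 * conf x ^ 3 * x $ j else 0)) else 0)"
    unfolding christoffel_def I pderiv_round_metric
    by (rule arg_cong [where f = "\<lambda>t. (1/2) * t"], rule sum.cong [OF refl]) auto
  also have "\<dots> = conf x * ((if i = m then x $ j else 0) - (if j = m then x $ i else 0) - (if j = i then x $ m else 0))"
    by (simp add: power2_eq_square power3_eq_cube)
  finally show ?thesis .
qed

lemma frame_eq: "frame a x = (1 / conf x) *\<^sub>R axis a 1"
  by (simp add: frame_def conf_def)

lemma spin_connection_eq:
  fixes x :: "real ^ 'd::finite"
  shows "spin_connection k c i a b x =
    conf x * ((if i = b then x $ a else 0) - (if i = a then x $ b else 0))"
proof -
  have D: "pderiv_vec i (\<lambda>y. frame b y $ l) x = (if l = b then x $ i else 0)" for l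
  proof -
    have "((\<lambda>y. frame b y $ l) has_derivative (\<lambda>h. (if l = b then x \<bullet> h else 0))) (at x)"
      unfolding frame_def
      by (auto simp: axis_def inner_commute intro!: derivative_eq_intros)
    from pderiv_vec_eq [OF this, of i] show ?thesis by (simp add: inner_axis)
  qed
  have C: "(\<Sum>m\<in>UNIV. christoffel k c l i m x * frame b x $ m) = christoffel k c l i b x / conf x" for l
    by (simp add: frame_eq axis_def if_distrib [where f = "\<lambda>x. _ * x"] cong: if_cong)
  have "spin_connection k c i a b x = (\<Sum>j\<in>UNIV. \<Sum>l\<in>UNIV. if l = a then if j = a then
      conf x * ((if a = b then x $ i else 0) + christoffel k c a i b x / conf x) else 0 else 0)"
    unfolding spin_connection_def D C
    by (intro sum.cong refl) (auto simp: round_metric_mat mat_def frame_eq axis_def power2_eq_square)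
  also have "\<dots> = conf x * ((if a = b then x $ i else 0) + christoffel k c a i b x / conf x)"
    by simp
  also have "\<dots> = conf x * ((if i = b then x $ a else 0) - (if i = a then x $ b else 0))"
    using conf_pos [of x] by (auto simp: christoffel_eq)
  finally show ?thesis .
qed

section \<open>Clifford multiplication and the Dirac operator\<close>

lemma matrix_vector_scaleR:
  fixes A :: "complex ^ 'n ^ 'm"
  shows "A *v (c *\<^sub>R u) = c *\<^sub>R (A *v u)" "(c *\<^sub>R A) *v u = c *\<^sub>R (A *v u)"
  by (simp_all add: matrix_vector_mult_def vec_eq_iff scaleR_sum_right)

lemma gamma_anticommute:
  assumes "gamma_matrices \<gamma>"
  shows "\<gamma> a *v (\<gamma> b *v u) + \<gamma> b *v (\<gamma> a *v u) = (if a = b then 2 *\<^sub>R u else 0)"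
proof -
  have "mat 2 *v u = 2 *\<^sub>R u"
    by (simp add: matrix_vector_mult_def mat_def vec_eq_iff if_distrib [where f = "\<lambda>x. x * _"]
        scaleR_conv_of_real cong: if_cong)
  then show ?thesis
    using assms
    by (simp add: gamma_matrices_def matrix_vector_mul_assoc matrix_vector_mult_add_rdistrib [symmetric])
qed

lemma gamma_square:
  assumes "gamma_matrices \<gamma>"
  shows "\<gamma> a *v (\<gamma> a *v u) = u"
proof -
  have "2 *\<^sub>R (\<gamma> a *v (\<gamma> a *v u)) = 2 *\<^sub>R u"
    using gamma_anticommute [OF assms, of a a u] by (simp add: scaleR_2)
  then show ?thesis by (metis real_vector.scale_cancel_left zero_neq_numeral)
qed

lemma sum_matrix_vector: "(\<Sum>a\<in>S. f a) *v u = (\<Sum>a\<in>S. f a *v u)" for u :: "complex ^ 'n"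
  by (induction S rule: infinite_finite_induct) (simp_all add: matrix_vector_mult_add_rdistrib)

lemma clifford_apply: "clifford \<gamma> x *v u = (\<Sum>a\<in>UNIV. x $ a *\<^sub>R (\<gamma> a *v u))"
  by (simp add: clifford_def sum_matrix_vector matrix_vector_scaleR)

lemma matrix_vector_sum: "A *v (\<Sum>a\<in>S. f a) = (\<Sum>a\<in>S. A *v f a)" for A :: "complex ^ 'n ^ 'm"
  by (induction S rule: infinite_finite_induct) (simp_all add: matrix_vector_right_distrib)

lemma clifford_anticommute:
  assumes "gamma_matrices \<gamma>"
  shows "\<gamma> a *v (clifford \<gamma> x *v u) + clifford \<gamma> x *v (\<gamma> a *v u) = (2 * x $ a) *\<^sub>R u"
proof -
  have "\<gamma> a *v (clifford \<gamma> x *v u) + clifford \<gamma> x *v (\<gamma> a *v u)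
      = (\<Sum>b\<in>UNIV. x $ b *\<^sub>R (\<gamma> a *v (\<gamma> b *v u) + \<gamma> b *v (\<gamma> a *v u)))"
    by (simp add: clifford_apply matrix_vector_sum matrix_vector_scaleR sum.distrib scaleR_add_right)
  also have "\<dots> = (\<Sum>b\<in>UNIV. if b = a then (2 * x $ a) *\<^sub>R u else 0)"
    by (intro sum.cong refl) (auto simp: gamma_anticommute [OF assms])
  finally show ?thesis by simp
qed

lemma spin_deriv_eq:
  "spin_deriv \<gamma> k i u c x = pderiv_vec i (u c) x
     - (conf x / 4) *\<^sub>R (\<gamma> i *v (clifford \<gamma> x *v u c x) - clifford \<gamma> x *v (\<gamma> i *v u c x))"
proof -
  define v where "v = u c x"
  define B where "B a b = \<gamma> a *v (\<gamma> b *v v) - \<gamma> b *v (\<gamma> a *v v)" for a b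
  have "(\<Sum>a\<in>UNIV. \<Sum>b\<in>UNIV. spin_connection k c i a b x *\<^sub>R ((\<gamma> a ** \<gamma> b - \<gamma> b ** \<gamma> a) *v v))
      = (\<Sum>a\<in>UNIV. \<Sum>b\<in>UNIV. (if i = b then (conf x * x $ a) *\<^sub>R B a b else 0)
           - (if i = a then (conf x * x $ b) *\<^sub>R B a b else 0))"
  proof (intro sum.cong refl)
    fix a b
    have "(\<gamma> a ** \<gamma> b - \<gamma> b ** \<gamma> a) *v v = B a b"
      unfolding B_def matrix_vector_mult_diff_rdistrib matrix_vector_mul_assoc ..
    then show "spin_connection k c i a b x *\<^sub>R ((\<gamma> a ** \<gamma> b - \<gamma> b ** \<gamma> a) *v v)
      = (if i = b then (conf x * x $ a) *\<^sub>R B a b else 0) - (if i = a then (conf x * x $ b) *\<^sub>R B a b else 0)"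
      by (simp only: spin_connection_eq)
        (cases "i = a"; cases "i = b"; simp add: right_diff_distrib scaleR_diff_left)
  qed
  also have "\<dots> = (\<Sum>a\<in>UNIV. (conf x * x $ a) *\<^sub>R B a i) - (\<Sum>b\<in>UNIV. (conf x * x $ b) *\<^sub>R B i b)"
  proof -
    have "(\<Sum>a\<in>UNIV. \<Sum>b\<in>UNIV. if i = a then (conf x * x $ b) *\<^sub>R B a b else 0)
        = (\<Sum>a\<in>UNIV. if i = a then \<Sum>b\<in>UNIV. (conf x * x $ b) *\<^sub>R B a b else 0)"
      by (intro sum.cong refl) auto
    then show ?thesis by (simp add: sum_subtractf)
  qed
  also have "\<dots> = (- 2 * conf x) *\<^sub>R (\<gamma> i *v (clifford \<gamma> x *v v) - clifford \<gamma> x *v (\<gamma> i *v v))"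
  proof -
    have B: "B a i = - B i a" for a by (simp add: B_def)
    have "(\<Sum>a\<in>UNIV. (conf x * x $ a) *\<^sub>R B a i) - (\<Sum>b\<in>UNIV. (conf x * x $ b) *\<^sub>R B i b)
        = (- 2 * conf x) *\<^sub>R (\<Sum>b\<in>UNIV. x $ b *\<^sub>R B i b)"
      unfolding scaleR_sum_right sum_subtractf [symmetric]
    proof (intro sum.cong refl)
      fix b
      show "(conf x * x $ b) *\<^sub>R B b i - (conf x * x $ b) *\<^sub>R B i b = (- 2 * conf x) *\<^sub>R x $ b *\<^sub>R B i b"
        unfolding B [of b] by (simp add: vec_eq_iff scaleR_conv_of_real)
    qed
    also have "(\<Sum>b\<in>UNIV. x $ b *\<^sub>R B i b) = \<gamma> i *v (clifford \<gamma> x *v v) - clifford \<gamma> x *v (\<gamma> i *v v)"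
      by (simp add: B_def clifford_apply matrix_vector_sum matrix_vector_scaleR scaleR_diff_right sum_subtractf)
    finally show ?thesis .
  qed
  finally have S: "(\<Sum>a\<in>UNIV. \<Sum>b\<in>UNIV. spin_connection k c i a b x *\<^sub>R ((\<gamma> a ** \<gamma> b - \<gamma> b ** \<gamma> a) *v v))
      = (- 2 * conf x) *\<^sub>R (\<gamma> i *v (clifford \<gamma> x *v v) - clifford \<gamma> x *v (\<gamma> i *v v))" .
  show ?thesis
    unfolding spin_deriv_def v_def [symmetric] S by simp
qed

text \<open>
  The spin connection of a conformally flat metric contributes only a multiple of Clifford
  multiplication by the gradient of the logarithm of the conformal factor: in the sum over \<open>i\<close> the
  terms \<open>\<gamma> i\<close> times the commutator of \<open>\<gamma> i\<close> with \<open>clifford \<gamma> x\<close> combine by the Clifford relations.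
\<close>

lemma dirac_eq:
  fixes \<gamma> :: "'d::finite \<Rightarrow> complex ^ 'n ^ 'n::finite"
  assumes \<gamma>: "gamma_matrices \<gamma>"
  shows "dirac \<gamma> k u c x = (- \<i>) *s ((1 / conf x) *\<^sub>R (\<Sum>a\<in>UNIV. \<gamma> a *v pderiv_vec a (u c) x)
     - ((real CARD('d) - 1) / 2) *\<^sub>R (clifford \<gamma> x *v u c x))"
proof -
  define v where "v = u c x"
  define X where "X w = clifford \<gamma> x *v w" for w
  have X: "\<gamma> a *v X w = (2 * x $ a) *\<^sub>R w - X (\<gamma> a *v w)" for a w
    using clifford_anticommute [OF \<gamma>, of a x w] by (simp add: X_def algebra_simps)
  have S0: "\<gamma> a *v (\<gamma> a *v X v - X (\<gamma> a *v v)) = 2 *\<^sub>R X v - (2 * x $ a) *\<^sub>R (\<gamma> a *v v)" for a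
  proof -
    have "\<gamma> a *v X (\<gamma> a *v v) = (2 * x $ a) *\<^sub>R (\<gamma> a *v v) - X v"
      using X [of a "\<gamma> a *v v"] by (simp add: gamma_square [OF \<gamma>])
    then have "\<gamma> a *v (\<gamma> a *v X v - X (\<gamma> a *v v)) = X v - ((2 * x $ a) *\<^sub>R (\<gamma> a *v v) - X v)"
      by (simp only: matrix_vector_mult_diff_distrib gamma_square [OF \<gamma>])
    then show ?thesis by (simp only: scaleR_2 diff_diff_eq2 diff_add_eq)
  qed
  have S: "(\<Sum>a\<in>UNIV. \<gamma> a *v (\<gamma> a *v X v - X (\<gamma> a *v v))) = (2 * (real CARD('d) - 1)) *\<^sub>R X v"
  proof -
    have "(\<Sum>a\<in>UNIV. (2 * x $ a) *\<^sub>R (\<gamma> a *v v)) = 2 *\<^sub>R X v"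
      unfolding X_def clifford_apply scaleR_sum_right by simp
    moreover have "(\<Sum>a\<in>(UNIV :: 'd set). 2 *\<^sub>R X v) = (2 * real CARD('d)) *\<^sub>R X v"
      by (simp only: sum_constant_scaleR scaleR_scaleR) (simp add: mult.commute)
    ultimately show ?thesis
      unfolding S0 sum_subtractf by (simp add: scaleR_diff_left [symmetric] right_diff_distrib)
  qed
  have "(\<Sum>i\<in>UNIV. (frame a x $ i) *\<^sub>R (\<gamma> a *v spin_deriv \<gamma> k i u c x)) =
      (\<Sum>i\<in>UNIV. if i = a then (1 / conf x) *\<^sub>R (\<gamma> a *v spin_deriv \<gamma> k a u c x) else 0)" for a
    by (intro sum.cong refl) (auto simp: frame_eq axis_def)
  then have "(\<Sum>a\<in>UNIV. \<Sum>i\<in>UNIV. (frame a x $ i) *\<^sub>R (\<gamma> a *v spin_deriv \<gamma> k i u c x))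
     = (1 / conf x) *\<^sub>R (\<Sum>a\<in>UNIV. \<gamma> a *v spin_deriv \<gamma> k a u c x)"
    by (simp add: scaleR_sum_right)
  also have "(\<Sum>a\<in>UNIV. \<gamma> a *v spin_deriv \<gamma> k a u c x) =
     (\<Sum>a\<in>UNIV. \<gamma> a *v pderiv_vec a (u c) x) - (conf x / 4) *\<^sub>R ((2 * (real CARD('d) - 1)) *\<^sub>R X v)"
  proof -
    have "\<gamma> a *v spin_deriv \<gamma> k a u c x
        = \<gamma> a *v pderiv_vec a (u c) x - (conf x / 4) *\<^sub>R (\<gamma> a *v (\<gamma> a *v X v - X (\<gamma> a *v v)))" for a
      unfolding spin_deriv_eq X_def v_def matrix_vector_mult_diff_distrib matrix_vector_scaleR ..
    then show ?thesis
      unfolding S [symmetric] scaleR_sum_right sum_subtractf [symmetric] by (rule sum.cong [OF refl])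
  qed
  finally show ?thesis
    using conf_pos [of x] by (simp add: dirac_def X_def v_def scaleR_diff_right)
qed

text \<open>
  The Hermitian product of two spinors at a point. The class \<open>real_inner\<close> only provides its real part.
\<close>

definition cinner :: "complex ^ 'n::finite \<Rightarrow> complex ^ 'n \<Rightarrow> complex" where
  "cinner u v = (\<Sum>i\<in>UNIV. cnj (u $ i) * v $ i)"

lemma norm_cinner_le: "norm (cinner u v) \<le> norm u * norm v * real CARD('n)" for u v :: "complex ^ 'n::finite"
proof -
  have "norm (cinner u v) \<le> (\<Sum>i\<in>(UNIV :: 'n set). norm u * norm v)"
    unfolding cinner_def
    by (rule sum_norm_le) (simp add: norm_mult mult_mono Finite_Cartesian_Product.norm_nth_le)
  then show ?thesis by (simp add: mult.commute)
qed

lemma bounded_bilinear_cinner: "bounded_bilinear cinner"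
proof
  show "\<exists>K. \<forall>u v :: complex ^ 'n. norm (cinner u v) \<le> norm u * norm v * K"
    by (intro exI [of _ "real CARD('n)"] allI norm_cinner_le)
qed (simp_all add: cinner_def algebra_simps sum.distrib scaleR_sum_right)

interpretation cinner: bounded_bilinear cinner
  by (rule bounded_bilinear_cinner)

lemma cinner_scale:
  "cinner (c *s u) v = cnj c * cinner u v" "cinner u (c *s v) = c * cinner u v"
  by (simp_all add: cinner_def sum_distrib_left mult_ac)

lemma cinner_self: "cinner u u = complex_of_real ((norm u)\<^sup>2)"
proof -
  have "(norm u)\<^sup>2 = (\<Sum>i\<in>UNIV. (norm (u $ i))\<^sup>2)"
    by (simp add: norm_vec_def L2_set_def sum_nonneg)
  then show ?thesis
    by (simp only: of_real_sum complex_norm_square cinner_def mult.commute)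
qed

lemma cinner_gamma:
  assumes "gamma_matrices \<gamma>"
  shows "cinner (\<gamma> a *v u) v = cinner u (\<gamma> a *v v)"
proof -
  have "cnj (\<gamma> a $ i $ j) = \<gamma> a $ j $ i" for i j
    using assms unfolding gamma_matrices_def by (metis complex_cnj_cnj)
  then have "cinner (\<gamma> a *v u) v = (\<Sum>i\<in>UNIV. \<Sum>j\<in>UNIV. cnj (u $ j) * (\<gamma> a $ j $ i * v $ i))"
    by (simp add: cinner_def matrix_vector_mult_def sum_distrib_left mult_ac)
  also have "\<dots> = cinner u (\<gamma> a *v v)"
    by (subst sum.swap) (simp add: cinner_def matrix_vector_mult_def sum_distrib_left)
  finally show ?thesis .
qed

lemma cinner_clifford:
  assumes "gamma_matrices \<gamma>"
  shows "cinner (clifford \<gamma> x *v u) v = cinner u (clifford \<gamma> x *v v)"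
  by (simp add: clifford_apply cinner.sum_left cinner.sum_right cinner.scaleR_left cinner.scaleR_right
      cinner_gamma [OF assms])

lemma clifford_square:
  assumes \<gamma>: "gamma_matrices \<gamma>"
  shows "clifford \<gamma> x *v (clifford \<gamma> x *v u) = (x \<bullet> x) *\<^sub>R u"
proof -
  define X where "X w = clifford \<gamma> x *v w" for w
  have "X (X u) = (\<Sum>a\<in>UNIV. x $ a *\<^sub>R ((2 * x $ a) *\<^sub>R u - X (\<gamma> a *v u)))"
    using clifford_anticommute [OF \<gamma>, of _ x u]
    by (subst X_def, subst clifford_apply, intro sum.cong refl arg_cong2 [where f = scaleR])
      (simp add: X_def algebra_simps)
  also have "\<dots> = (2 * (x \<bullet> x)) *\<^sub>R u - (\<Sum>a\<in>UNIV. x $ a *\<^sub>R X (\<gamma> a *v u))"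
    by (simp add: scaleR_diff_right sum_subtractf inner_vec_def sum_distrib_left scaleR_sum_left mult_ac)
  also have "(\<Sum>a\<in>UNIV. x $ a *\<^sub>R X (\<gamma> a *v u)) = X (X u)"
    by (simp add: X_def clifford_apply [of \<gamma> x u] matrix_vector_sum matrix_vector_scaleR)
  finally have "2 *\<^sub>R X (X u) = 2 *\<^sub>R ((x \<bullet> x) *\<^sub>R u)"
    by (simp add: scaleR_2 algebra_simps)
  then show ?thesis unfolding X_def by (metis real_vector.scale_cancel_left zero_neq_numeral)
qed

lemma norm_clifford:
  assumes "gamma_matrices \<gamma>"
  shows "norm (clifford \<gamma> x *v u) = norm x * norm u"
proof -
  have "cinner (clifford \<gamma> x *v u) (clifford \<gamma> x *v u) = (x \<bullet> x) *\<^sub>R cinner u u"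
    by (simp add: cinner_clifford [OF assms] clifford_square [OF assms] cinner.scaleR_right)
  then have "complex_of_real ((norm (clifford \<gamma> x *v u))\<^sup>2) = complex_of_real ((norm x * norm u)\<^sup>2)"
    by (simp only: cinner_self scaleR_conv_of_real [where 'a = complex] of_real_mult [symmetric] power_mult_distrib power2_norm_eq_inner)
  then show ?thesis
    by (metis norm_ge_zero mult_nonneg_nonneg of_real_eq_iff power2_eq_imp_eq)
qed

lemma norm_gamma:
  assumes "gamma_matrices \<gamma>"
  shows "norm (\<gamma> a *v u) = norm u"
proof -
  have "complex_of_real ((norm (\<gamma> a *v u))\<^sup>2) = complex_of_real ((norm u)\<^sup>2)"
    by (simp only: cinner_self [symmetric] cinner_gamma [OF assms] gamma_square [OF assms])
  then show ?thesis
    by (metis norm_ge_zero of_real_eq_iff power2_eq_imp_eq)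
qed

section \<open>The radial equation\<close>

text \<open>
  The radial part of the eigenvalue equation for \<open>zonal_field\<close>, with \<open>h = d / 2\<close> and \<open>z\<close> the
  height on the sphere. The two radial components of a spinor satisfy a system that is exchanged by
  \<open>z \<mapsto> - z\<close>; the equation below is that system on the solutions whose components are reflections
  of each other.
\<close>

definition zonal_profile :: "real \<Rightarrow> real \<Rightarrow> real poly \<Rightarrow> bool" where
  "zonal_profile h l p \<longleftrightarrow> (\<forall>z. (1 + z) * poly (pderiv p) z + h * poly p z = l * poly p (- z))"

text \<open>
  Comparing coefficients gives a two-term recursion. A partial sum of the series satisfies the
  equation up to one monomial, whose factor vanishes at degree \<open>n\<close> when the eigenvalue is \<open>n + h\<close> and
  \<open>n\<close> is even. For odd \<open>n\<close> the sign in the reflection would have to change.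
\<close>

lemma zonal_profile_exists:
  assumes "even n"
  shows "\<exists>p. zonal_profile h (real n + h) p \<and> poly p 0 = 1"
proof -
  define l where "l = real n + h"
  define c where "c k = (\<Prod>j<k. ((-1) ^ j * l - real j - h) / (real j + 1))" for k
  define p where "p N = (\<Sum>k\<le>N. monom (c k) k)" for N
  have c: "(real k + 1) * c (Suc k) = ((-1) ^ k * l - real k - h) * c k" for k
    by (simp add: c_def field_simps)
  have 1: "(1 + z) * poly (pderiv (p N)) z + h * poly (p N) z - l * poly (p N) (- z)
      = (real N + h - (-1) ^ N * l) * c N * z ^ N" for N z
  proof (induction N)
    case 0
    show ?case by (simp add: p_def monom_0 algebra_simps)
  next
    case (Suc N)
    have "(1 + z) * poly (pderiv (p (Suc N))) z + h * poly (p (Suc N)) z - l * poly (p (Suc N)) (- z)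
       = (real N + h - (-1) ^ N * l) * c N * z ^ N + (1 + z) * ((real N + 1) * c (Suc N)) * z ^ N
        + h * c (Suc N) * z ^ Suc N - l * c (Suc N) * (- z) ^ Suc N"
      unfolding Suc [symmetric]
      by (simp add: p_def pderiv_add pderiv_monom poly_monom algebra_simps)
    also have "(1 + z) * ((real N + 1) * c (Suc N)) * z ^ N
       = ((-1) ^ N * l - real N - h) * c N * z ^ N + (real N + 1) * c (Suc N) * z ^ Suc N"
      unfolding c [symmetric] by (simp add: algebra_simps)
    finally show ?case
      by (simp add: power_minus [of z N] algebra_simps)
  qed
  have "zonal_profile h l (p n)"
    unfolding zonal_profile_def using 1 [of _ n] assms by (simp add: l_def algebra_simps)
  moreover have "poly (p n) 0 = 1"
    by (simp add: p_def poly_sum poly_monom power_0_left if_distrib [where f = "\<lambda>x. _ * x"] c_def cong: if_cong)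
  ultimately show ?thesis unfolding l_def by blast
qed

text \<open>
  Twice the squared norm of the zonal spinor with profile \<open>p\<close>, as a function of the height; see
  \<open>norm_zonal_field\<close>.
\<close>

definition zonal_energy :: "real poly \<Rightarrow> real \<Rightarrow> real" where
  "zonal_energy p z = (1 + z) * (poly p z)\<^sup>2 + (1 - z) * (poly p (- z))\<^sup>2"

lemma zonal_profileD:
  assumes "zonal_profile h l p"
  shows "(1 + z) * poly (pderiv p) z = l * poly p (- z) - h * poly p z"
    and "(1 - z) * - poly (pderiv p) (- z) = h * poly p (- z) - l * poly p z"
  using assms [unfolded zonal_profile_def, rule_format, of z]
    assms [unfolded zonal_profile_def, rule_format, of "- z"] by (auto simp: algebra_simps)

lemma poly_minus_DERIV [derivative_intros]:
  "((\<lambda>z. poly p (- z)) has_real_derivative - poly (pderiv p) (- z)) (at z)"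
  using DERIV_chain2 [OF poly_DERIV [of p "- z"] DERIV_minus [OF DERIV_ident]] by simp

lemma zonal_energy_DERIV:
  assumes "zonal_profile h l p"
  shows "(zonal_energy p has_real_derivative (2 * h - 1) * ((poly p (- z))\<^sup>2 - (poly p z)\<^sup>2)) (at z)"
proof -
  define P Q P' Q' where "P = poly p z" and "Q = poly p (- z)" and "P' = poly (pderiv p) z"
    and "Q' = - poly (pderiv p) (- z)"
  have "(zonal_energy p has_real_derivative P\<^sup>2 - Q\<^sup>2 + 2 * P * ((1 + z) * P') + 2 * Q * ((1 - z) * Q')) (at z)"
    unfolding zonal_energy_def P_def Q_def P'_def Q'_def
    by (rule derivative_eq_intros poly_DERIV refl | simp add: algebra_simps power2_eq_square)+
  moreover have "P\<^sup>2 - Q\<^sup>2 + 2 * P * ((1 + z) * P') + 2 * Q * ((1 - z) * Q') = (2 * h - 1) * (Q\<^sup>2 - P\<^sup>2)"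
    unfolding P'_def Q'_def zonal_profileD [OF assms] by (simp add: P_def Q_def algebra_simps power2_eq_square)
  ultimately show ?thesis by (simp add: P_def Q_def)
qed

lemma zonal_energy_nonneg: "\<bar>z\<bar> \<le> 1 \<Longrightarrow> zonal_energy p z \<ge> 0"
  by (simp add: zonal_energy_def)

text \<open>
  The energy of the conformally rescaled spinor, which solves the flat equation with a radial
  potential, decreases along rays from the pole \<open>z = 1\<close>. The rescaling is the weight \<open>(1 + z) ^ D\<close>.
\<close>

lemma zonal_energy_le_pole:
  assumes p: "zonal_profile ((real D + 1) / 2) l p" and z: "0 \<le> z" "z \<le> 1"
  shows "zonal_energy p z \<le> 2 ^ (D + 1) * (poly p 1)\<^sup>2"
proof -
  have "(1 + z) ^ D * zonal_energy p z \<le> (1 + 1) ^ D * zonal_energy p 1"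
  proof (rule DERIV_nonneg_imp_nondecreasing [OF z(2)])
    fix t assume t: "z \<le> t" "t \<le> 1"
    define P Q where "P = poly p t" and "Q = poly p (- t)"
    have E: "(zonal_energy p has_real_derivative D * (Q\<^sup>2 - P\<^sup>2)) (at t)"
      using zonal_energy_DERIV [OF p, of t] by (simp add: P_def Q_def add_divide_distrib)
    have "((\<lambda>z. (1 + z) ^ D * zonal_energy p z) has_real_derivative
       real D * (1 + t) ^ (D - 1) * zonal_energy p t + (1 + t) ^ D * (D * (Q\<^sup>2 - P\<^sup>2))) (at t)"
      by (rule derivative_eq_intros E refl | simp)+
    moreover have "real D * (1 + t) ^ (D - 1) * zonal_energy p t + (1 + t) ^ D * (D * (Q\<^sup>2 - P\<^sup>2))
       = 2 * real D * (1 + t) ^ (D - 1) * Q\<^sup>2"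
      by (cases D) (simp_all add: zonal_energy_def P_def Q_def algebra_simps)
    ultimately show "\<exists>y. ((\<lambda>z. (1 + z) ^ D * zonal_energy p z) has_real_derivative y) (at t) \<and> 0 \<le> y"
      using t z by auto
  qed
  moreover have "1 * zonal_energy p z \<le> (1 + z) ^ D * zonal_energy p z"
    using z by (intro mult_right_mono zonal_energy_nonneg one_le_power) auto
  ultimately show ?thesis by (simp add: zonal_energy_def)
qed

text \<open>A profile cannot vanish at the pole, because its energy there controls \<open>p 0\<close>.\<close>

lemma zonal_profile_normalized:
  assumes "even n"
  shows "\<exists>p. zonal_profile ((real D + 1) / 2) (real n + (real D + 1) / 2) p \<and> poly p 1 = 1"
proof -
  obtain p where p: "zonal_profile ((real D + 1) / 2) (real n + (real D + 1) / 2) p" "poly p 0 = 1"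
    using zonal_profile_exists [OF assms] by blast
  have "poly p 1 \<noteq> 0"
    using zonal_energy_le_pole [OF p(1), of 0] p(2) by (auto simp: zonal_energy_def)
  moreover have "zonal_profile ((real D + 1) / 2) (real n + (real D + 1) / 2) (smult c p)" for c
    unfolding zonal_profile_def
  proof
    fix z
    have "(1 + z) * (c * poly (pderiv p) z) + (real D + 1) / 2 * (c * poly p z)
      = c * ((1 + z) * poly (pderiv p) z + (real D + 1) / 2 * poly p z)"
      by (simp only: distrib_left mult_ac)
    then show "(1 + z) * poly (pderiv (smult c p)) z + (real D + 1) / 2 * poly (smult c p) z
        = (real n + (real D + 1) / 2) * poly (smult c p) (- z)"
      using p(1) by (simp add: zonal_profile_def pderiv_smult)
  qed
  ultimately show ?thesis
    by (intro exI [of _ "smult (1 / poly p 1) p"]) simp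
qed

text \<open>
  The equation bounds the derivative of \<open>p\<close> by \<open>l\<close> times the sizes of \<open>p\<close> and of its
  reflection; on the latter the energy gives only a bound by a multiple of \<open>1 / sqrt (1 - z)\<close>. That singularity is integrable, and
  integrating it costs \<open>sqrt (1 - z)\<close>, which is the distance to the pole up to constants.
\<close>

lemma zonal_profile_near_pole:
  assumes p: "zonal_profile ((real D + 1) / 2) l p" "poly p 1 = 1"
    and l: "(real D + 1) / 2 \<le> l" and z: "0 \<le> z" "z \<le> 1"
  shows "poly p z \<ge> 1 - l * 2 ^ (D + 3) * sqrt (1 - z)"
proof (cases "z = 1")
  case False
  then have z1: "z < 1" using z by simp
  define K where "K = l * 2 ^ (D + 3)"
  \<comment> \<open>The added term absorbs the integrated bound on the derivative, so that \<open>g\<close> decreases.\<close>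
  define g where "g t = poly p t + K * sqrt (1 - t)" for t
  have "g z \<ge> g 1"
  proof (rule DERIV_nonpos_imp_decreasing_open [where f = g])
    show "continuous_on {z..1} g"
      unfolding g_def by (intro continuous_intros)
    fix t assume t: "z < t" "t < 1"
    define P Q where "P = poly p t" and "Q = poly p (- t)"
    define B where "B = (2 :: real) ^ (D + 1) / sqrt (1 - t)"
    have st: "0 < sqrt (1 - t)" "sqrt (1 - t) \<le> 1" using t z by auto
    have E: "(1 + t) * P\<^sup>2 + (1 - t) * Q\<^sup>2 \<le> (2 ^ (D + 1))\<^sup>2"
    proof -
      have "(1 + t) * P\<^sup>2 + (1 - t) * Q\<^sup>2 \<le> 2 ^ (D + 1)"
        using zonal_energy_le_pole [OF p(1), of t] t z p(2) by (simp add: zonal_energy_def P_def Q_def)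
      also have "\<dots> \<le> (2 ^ (D + 1))\<^sup>2"
        using one_le_power [of "2 :: real" "D + 1"] by (simp add: power2_eq_square)
      finally show ?thesis .
    qed
    have "(sqrt (1 - t) * \<bar>Q\<bar>)\<^sup>2 \<le> (2 ^ (D + 1))\<^sup>2"
      using E t z zero_le_power2 [of P] by (auto simp: power_mult_distrib intro: order_trans [rotated])
    then have Q: "\<bar>Q\<bar> \<le> B"
      using power2_le_imp_le [of "sqrt (1 - t) * \<bar>Q\<bar>" "2 ^ (D + 1)"] st by (simp add: B_def field_simps)
    have "\<bar>P\<bar>\<^sup>2 \<le> (2 ^ (D + 1))\<^sup>2"
    proof -
      have "P\<^sup>2 \<le> (1 + t) * P\<^sup>2" using t z by (simp add: distrib_right)
      also have "\<dots> \<le> (2 ^ (D + 1))\<^sup>2" using E t z by (smt (verit) mult_nonneg_nonneg zero_le_power2)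
      finally show ?thesis by simp
    qed
    then have "\<bar>P\<bar> \<le> 2 ^ (D + 1)" by (rule power2_le_imp_le) simp
    also have "\<dots> \<le> B" using st by (simp add: B_def field_simps)
    finally have P: "\<bar>P\<bar> \<le> B" .
    have B0: "B \<ge> 0" using st by (simp add: B_def)
    have "(1 + t) * poly (pderiv p) t = l * Q - (real D + 1) / 2 * P"
      using zonal_profileD(1) [OF p(1), of t] by (simp add: P_def Q_def)
    then have "(1 + t) * \<bar>poly (pderiv p) t\<bar> = \<bar>l * Q - (real D + 1) / 2 * P\<bar>"
      using t z by (metis abs_mult abs_of_nonneg add_nonneg_nonneg less_eq_real_def order_trans zero_le_one)
    also have "\<dots> \<le> \<bar>l * Q\<bar> + \<bar>(real D + 1) / 2 * P\<bar>" by (rule abs_triangle_ineq4)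
    also have "\<bar>l * Q\<bar> = l * \<bar>Q\<bar>" using l by (simp add: abs_mult)
    also have "\<bar>(real D + 1) / 2 * P\<bar> = (real D + 1) / 2 * \<bar>P\<bar>" by (simp add: abs_mult)
    also have "l * \<bar>Q\<bar> + (real D + 1) / 2 * \<bar>P\<bar> \<le> l * B + l * B"
      using l P Q B0 by (intro add_mono mult_mono) auto
    finally have "(1 + t) * \<bar>poly (pderiv p) t\<bar> \<le> 2 * l * B" by (simp add: mult_ac)
    moreover have "1 * \<bar>poly (pderiv p) t\<bar> \<le> (1 + t) * \<bar>poly (pderiv p) t\<bar>"
      using t z by (intro mult_right_mono) auto
    ultimately have "poly (pderiv p) t \<le> 2 * l * B" by linarith
    moreover have "(g has_real_derivative poly (pderiv p) t - K / (2 * sqrt (1 - t))) (at t)"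
      unfolding g_def using t by (auto intro!: derivative_eq_intros poly_DERIV simp: field_simps)
    moreover have "K / (2 * sqrt (1 - t)) = 2 * l * B"
      by (simp add: K_def B_def power_add)
    ultimately show "\<exists>y. (g has_real_derivative y) (at t) \<and> y \<le> 0"
      by (metis diff_le_0_iff_le)
  qed (use z in auto)
  then show ?thesis by (simp add: g_def K_def p)
qed (simp add: p)

text \<open>
  Here \<open>1 - z\<^sup>2\<close> is the squared sine of the polar angle. The derivative of the weighted energy
  \<open>S powr m * zonal_energy p\<close> is of the order of the energy itself, but it oscillates: up to a
  term of order \<open>1 / l\<close> it is the derivative of \<open>D / l\<close> times \<open>S powr m * p z * p (- z)\<close>.
  Subtracting that product gives \<open>H\<close>, whose logarithmic derivative is bounded by
  \<open>D / l * S powr (- 3 / 2)\<close>. The integral of this bound is \<open>D / l * z / sqrt S\<close>, which is at most one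
  up to the height \<open>z1\<close> where \<open>sqrt S = D / l\<close>. Beyond \<open>z1\<close> the bound by the value at the pole
  is good enough.
\<close>

lemma zonal_energy_decay_half:
  assumes p: "zonal_profile ((real D + 1) / 2) l p"
    and D: "D > 0" "real D \<le> l" and z: "0 \<le> z" "z < 1"
  shows "(1 - z\<^sup>2) powr (D / 2) * zonal_energy p z \<le> 9 * 2 ^ (D + 1) * (D / l) ^ D * (poly p 1)\<^sup>2"
proof -
  define e where "e = D / l"
  have e: "0 < e" "e \<le> 1" using D by (simp_all add: e_def)
  define m where "m = real D / 2"
  define S where "S t = 1 - t\<^sup>2" for t :: real
  define z1 where "z1 = sqrt (1 - e\<^sup>2)"
  have e2: "e\<^sup>2 \<le> 1" using e by (simp add: power_le_one)
  have z1: "0 \<le> z1" "z1 < 1" "S z1 = e\<^sup>2"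
    using e e2 by (simp_all add: z1_def S_def)
  have eD: "(e\<^sup>2) powr m = e ^ D"
  proof -
    have "e\<^sup>2 = e powr 2" using e by simp
    then show ?thesis using e by (simp only: powr_powr m_def) (simp add: powr_realpow)
  qed
  define M where "M = 2 ^ (D + 1) * (poly p 1)\<^sup>2"
  have W: "zonal_energy p t \<le> M" if "0 \<le> t" "t \<le> 1" for t
    using zonal_energy_le_pole [OF p that] by (simp add: M_def)
  have M0: "0 \<le> M" by (simp add: M_def)
  have "(S z) powr m * zonal_energy p z \<le> 9 * e ^ D * M"
  proof (cases "z \<le> z1")
    case False
    then have "S z \<le> S z1" using power_mono [of z1 z 2] z1(1) by (simp add: S_def)
    then have "S z powr m \<le> e ^ D"
      unfolding eD [symmetric] z1(3) [symmetric] using z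
      by (intro powr_mono2) (auto simp: S_def m_def power_le_one)
    then have "S z powr m * zonal_energy p z \<le> e ^ D * M"
      using W [of z] z e by (intro mult_mono zonal_energy_nonneg) auto
    also have "\<dots> \<le> 9 * e ^ D * M"
      using M0 e by (simp add: mult_le_cancel_right1)
    finally show ?thesis .
  next
    case True
    define H where "H t = S t powr m * (zonal_energy p t - e * (poly p t * poly p (- t)))" for t
    \<comment> \<open>The exponential is the integrating factor that makes the modified energy increase.\<close>
    define K where "K t = H t * exp (e * (t * S t powr (- 1 / 2)))" for t
    have PQ: "e * \<bar>poly p t * poly p (- t)\<bar> \<le> zonal_energy p t / 2 * (e * S t powr (- 1 / 2))"
      and eS: "e * S t powr (- 1 / 2) \<le> 1" and S0: "S t > 0" if t: "0 \<le> t" "t \<le> z1" for t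
    proof -
      have "S z1 \<le> S t" using power_mono [of t z1 2] t by (simp add: S_def)
      then have *: "e\<^sup>2 \<le> S t" using z1 by simp
      then show S0: "S t > 0" using e by (smt (verit) zero_less_power2)
      have r: "S t powr (- 1 / 2) = 1 / sqrt (S t)"
        using S0 powr_minus_divide [of "S t" "1 / 2"] powr_half_sqrt [of "S t"] by simp
      have "e \<le> sqrt (S t)" using * e real_le_rsqrt by blast
      then show "e * S t powr (- 1 / 2) \<le> 1"
        unfolding r using S0 by (simp add: field_simps)
      define P Q where "P = poly p t" and "Q = poly p (- t)"
      have "2 * ((sqrt (1 + t) * \<bar>P\<bar>) * (sqrt (1 - t) * \<bar>Q\<bar>)) \<le> (sqrt (1 + t) * \<bar>P\<bar>)\<^sup>2 + (sqrt (1 - t) * \<bar>Q\<bar>)\<^sup>2"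
        using sum_squares_bound [of "sqrt (1 + t) * \<bar>P\<bar>" "sqrt (1 - t) * \<bar>Q\<bar>"] by (simp add: mult.assoc)
      also have "\<dots> = zonal_energy p t"
        using t z1 by (simp add: zonal_energy_def P_def Q_def power_mult_distrib)
      also have "(sqrt (1 + t) * \<bar>P\<bar>) * (sqrt (1 - t) * \<bar>Q\<bar>) = sqrt (S t) * \<bar>P * Q\<bar>"
      proof -
        have "S t = (1 + t) * (1 - t)" by (simp add: S_def algebra_simps power2_eq_square)
        then show ?thesis by (simp add: real_sqrt_mult abs_mult)
      qed
      finally have "\<bar>P * Q\<bar> \<le> zonal_energy p t / 2 * (1 / sqrt (S t))"
        using S0 by (simp add: field_simps)
      from mult_left_mono [OF this, of e]
      show "e * \<bar>poly p t * poly p (- t)\<bar> \<le> zonal_energy p t / 2 * (e * S t powr (- 1 / 2))"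
        unfolding r using e by (simp add: abs_mult P_def Q_def mult_ac)
    qed
    have half: "S t powr m * (zonal_energy p t / 2) \<le> H t"
      and H_le: "H t \<le> S t powr m * (3 / 2 * zonal_energy p t)" if t: "0 \<le> t" "t \<le> z1" for t
    proof -
      have "zonal_energy p t / 2 * (e * S t powr (- 1 / 2)) \<le> zonal_energy p t / 2 * 1"
        using t z1 by (intro mult_left_mono eS divide_nonneg_nonneg zonal_energy_nonneg) auto
      with PQ [OF t] have "e * \<bar>poly p t * poly p (- t)\<bar> \<le> zonal_energy p t / 2" by linarith
      then have *: "\<bar>e * (poly p t * poly p (- t))\<bar> \<le> zonal_energy p t / 2"
        using e by (simp add: abs_mult)
      have "zonal_energy p t / 2 \<le> zonal_energy p t - e * (poly p t * poly p (- t))"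
        "zonal_energy p t - e * (poly p t * poly p (- t)) \<le> 3 / 2 * zonal_energy p t"
        using abs_le_D1 [OF *] abs_le_D2 [OF *] by linarith+
      then show "S t powr m * (zonal_energy p t / 2) \<le> H t" "H t \<le> S t powr m * (3 / 2 * zonal_energy p t)"
        unfolding H_def by (blast intro: mult_left_mono powr_ge_zero)+
    qed
    have "K z \<le> K z1"
    proof (rule DERIV_nonneg_imp_nondecreasing [where f = K, OF True])
      fix t assume t: "z \<le> t" "t \<le> z1"
      then have t0: "0 \<le> t" using z by simp
      note S0 = S0 [OF t0 t(2)]
      define P Q P' Q' where "P = poly p t" and "Q = poly p (- t)" and "P' = poly (pderiv p) t"
        and "Q' = - poly (pderiv p) (- t)"
      have E: "(zonal_energy p has_real_derivative D * (Q\<^sup>2 - P\<^sup>2)) (at t)"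
        using zonal_energy_DERIV [OF p, of t] by (simp add: P_def Q_def add_divide_distrib)
      have S': "(S has_real_derivative - 2 * t) (at t)"
        unfolding S_def by (rule derivative_eq_intros refl | simp)+
      have powS: "((\<lambda>t. S t powr a) has_real_derivative - 2 * a * t * S t powr (a - 1)) (at t)" for a
        using DERIV_fun_powr [OF S' S0, of a] by (simp add: mult_ac)
      have SP: "S t powr a = S t powr (a - 1) * S t" for a
        using S0 powr_add [of "S t" "a - 1" 1] by simp
      have pq: "((\<lambda>t. poly p t * poly p (- t)) has_real_derivative P' * Q + P * Q') (at t)"
        unfolding P_def Q_def P'_def Q'_def by (rule derivative_eq_intros poly_DERIV refl | simp)+
      have H': "(H has_real_derivative - e * t * S t powr (m - 1) * (P * Q)) (at t)"
      proof -
        have "(H has_real_derivative (- 2 * m * t * S t powr (m - 1)) * (zonal_energy p t - e * (P * Q))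
            + (D * (Q\<^sup>2 - P\<^sup>2) - e * (P' * Q + P * Q')) * S t powr m) (at t)"
          unfolding H_def P_def Q_def
          by (rule DERIV_mult powS DERIV_diff E [unfolded P_def Q_def] DERIV_cmult pq [unfolded P_def Q_def])+
        moreover have "(- 2 * m * t * S t powr (m - 1)) * (zonal_energy p t - e * (P * Q))
            + (D * (Q\<^sup>2 - P\<^sup>2) - e * (P' * Q + P * Q')) * S t powr m
          = S t powr (m - 1) * (- D * t * (zonal_energy p t - e * (P * Q)) + D * (S t * (Q\<^sup>2 - P\<^sup>2))
              - e * (S t * (P' * Q + P * Q')))"
          by (subst SP) (simp add: m_def algebra_simps)
        moreover have "- D * t * (zonal_energy p t - e * (P * Q)) + D * (S t * (Q\<^sup>2 - P\<^sup>2))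
              - e * (S t * (P' * Q + P * Q')) = - e * t * (P * Q)"
        proof -
          have "S t * (P' * Q + P * Q') = (1 - t) * Q * ((1 + t) * P') + (1 + t) * P * ((1 - t) * Q')"
            by (simp add: S_def algebra_simps power2_eq_square)
          also have "\<dots> = l * ((1 - t) * Q\<^sup>2 - (1 + t) * P\<^sup>2) + (D + 1) * t * (P * Q)"
            unfolding P'_def Q'_def zonal_profileD [OF p]
            by (simp add: P_def Q_def power2_eq_square field_simps)
          finally have 1: "e * (S t * (P' * Q + P * Q'))
              = D * ((1 - t) * Q\<^sup>2 - (1 + t) * P\<^sup>2) + e * ((D + 1) * t * (P * Q))"
            using D by (simp add: e_def distrib_left)
          show ?thesis
            unfolding 1 by (simp add: zonal_energy_def S_def P_def Q_def power2_eq_square algebra_simps)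
        qed
        ultimately show ?thesis by (simp add: mult_ac)
      qed
      have X: "((\<lambda>t. t * S t powr (- 1 / 2)) has_real_derivative S t powr (- 3 / 2)) (at t)"
      proof -
        have "((\<lambda>t. t * S t powr (- 1 / 2)) has_real_derivative
            1 * S t powr (- 1 / 2) + (- 2 * (- 1 / 2) * t * S t powr (- 1 / 2 - 1)) * t) (at t)"
          by (rule DERIV_mult DERIV_ident powS)+
        also have "1 * S t powr (- 1 / 2) + (- 2 * (- 1 / 2) * t * S t powr (- 1 / 2 - 1)) * t
           = S t powr (- 3 / 2)"
          by (subst SP) (simp add: S_def algebra_simps power2_eq_square)
        finally show ?thesis .
      qed
      define ex where "ex = exp (e * (t * S t powr (- 1 / 2)))"
      have K': "(K has_real_derivative
          (- e * t * S t powr (m - 1) * (P * Q)) * ex + (ex * (e * S t powr (- 3 / 2))) * H t) (at t)"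
        unfolding K_def ex_def by (rule DERIV_mult H' DERIV_fun_exp DERIV_cmult X)+
      have "e * t * S t powr (m - 1) * (P * Q) \<le> e * S t powr (- 3 / 2) * H t"
      proof -
        have "e * t * S t powr (m - 1) * (P * Q) \<le> 1 * S t powr (m - 1) * (e * \<bar>P * Q\<bar>)"
        proof -
          have "t * (e * (P * Q)) \<le> 1 * (e * \<bar>P * Q\<bar>)"
            using t0 t z1 e by (intro order_trans [OF mult_left_mono mult_right_mono]) auto
          from mult_left_mono [OF this, of "S t powr (m - 1)"] show ?thesis by (simp add: mult_ac)
        qed
        also have "\<dots> \<le> 1 * S t powr (m - 1) * (zonal_energy p t / 2 * (e * S t powr (- 1 / 2)))"
          using PQ [OF t0 t(2)] by (intro mult_left_mono) (auto simp: P_def Q_def)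
        also have "\<dots> = e * S t powr (- 3 / 2) * (S t powr m * (zonal_energy p t / 2))"
          using S0 powr_add [of "S t" "m - 1" "- 1 / 2"] powr_add [of "S t" "- 3 / 2" m]
          by (simp add: mult_ac)
        also have "\<dots> \<le> e * S t powr (- 3 / 2) * H t"
          using half [OF t0 t(2)] e by (intro mult_left_mono) auto
        finally show ?thesis .
      qed
      from mult_right_mono [OF this, of ex]
      have "0 \<le> (- e * t * S t powr (m - 1) * (P * Q)) * ex + (ex * (e * S t powr (- 3 / 2))) * H t"
        by (simp add: ex_def mult_ac)
      with K' show "\<exists>y. (K has_real_derivative y) (at t) \<and> 0 \<le> y" by blast
    qed
    have Hz: "0 \<le> H z"
      using half [OF z(1) True] zonal_energy_nonneg [of z p] z
      by (smt (verit) divide_nonneg_nonneg mult_nonneg_nonneg powr_ge_zero)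
    have "H z * 1 \<le> K z"
      unfolding K_def using Hz z e by (intro mult_left_mono) (auto simp: one_le_exp_iff)
    also note \<open>K z \<le> K z1\<close>
    also have "K z1 \<le> (e ^ D * (3 / 2 * M)) * 3"
      unfolding K_def
    proof (rule mult_mono)
      have "H z1 \<le> e ^ D * (3 / 2 * zonal_energy p z1)"
        using H_le [OF z1(1) order_refl] by (simp only: z1(3) eD)
      also have "\<dots> \<le> e ^ D * (3 / 2 * M)"
        using W [of z1] z1 e by (intro mult_left_mono) auto
      finally show "H z1 \<le> e ^ D * (3 / 2 * M)" .
      have "e * (z1 * S z1 powr (- 1 / 2)) \<le> 1"
        using mult_mono [OF eS [OF z1(1) order_refl] less_imp_le [OF z1(2)]] z1 by (simp add: mult_ac)
      then have "exp (e * (z1 * S z1 powr (- 1 / 2))) \<le> exp 1" by simp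
      then show "exp (e * (z1 * S z1 powr (- 1 / 2))) \<le> 3" using exp_le by linarith
    qed (use M0 e in auto)
    finally show ?thesis
      using half [OF z(1) True] by simp
  qed
  then show ?thesis by (simp add: S_def m_def e_def M_def mult_ac)
qed

lemma zonal_energy_even: "zonal_energy p (- z) = zonal_energy p z"
  by (simp add: zonal_energy_def)

lemma zonal_energy_decay:
  assumes "zonal_profile ((real D + 1) / 2) l p"
    and "D > 0" "real D \<le> l" and z: "\<bar>z\<bar> < 1"
  shows "(1 - z\<^sup>2) powr (D / 2) * zonal_energy p z \<le> 9 * 2 ^ (D + 1) * (D / l) ^ D * (poly p 1)\<^sup>2"
  using zonal_energy_decay_half [OF assms(1-3), of "\<bar>z\<bar>"] z
  by (cases "0 \<le> z") (simp_all add: zonal_energy_even)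

section \<open>Zonal eigenspinors\<close>

definition height :: "'a::real_inner \<Rightarrow> real" where
  "height x = (1 - x \<bullet> x) / (1 + x \<bullet> x)"

text \<open>
  The factor \<open>1 / sqrt (1 + x \<bullet> x)\<close> is the cosine of half the polar angle, and multiplied by
  \<open>norm x\<close> it is the sine of the half-angle: this is the usual separation of variables for the Dirac
  operator on the sphere.
\<close>

definition zonal_field ::
  "('d::finite \<Rightarrow> complex ^ 'n ^ 'n::finite) \<Rightarrow> real poly \<Rightarrow> complex ^ 'n \<Rightarrow> real ^ 'd \<Rightarrow> complex ^ 'n" where
  "zonal_field \<gamma> p v x = (1 / sqrt (1 + x \<bullet> x)) *\<^sub>R
     (poly p (height x) *\<^sub>R v + poly p (- height x) *\<^sub>R (clifford \<gamma> x *v (\<i> *s v)))"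

text \<open>
  Reflection of the height exchanges the two components of \<open>zonal_field\<close>, so the spinor has the same
  form in the southern chart, with the constant spinor turned by \<open>\<gamma> k\<close>. The factor \<open>\<i>\<close> compensates
  the \<open>\<i>\<close> in the second component.
\<close>

fun zonal_spinor ::
  "('d::finite \<Rightarrow> complex ^ 'n ^ 'n::finite) \<Rightarrow> 'd \<Rightarrow> real poly \<Rightarrow> complex ^ 'n \<Rightarrow> ('d, 'n) spinor" where
  "zonal_spinor \<gamma> k p v North = zonal_field \<gamma> p v"
| "zonal_spinor \<gamma> k p v South = zonal_field \<gamma> p (\<gamma> k *v (\<i> *s v))"

lemma one_plus_inner_pos [simp]: "1 + x \<bullet> x > 0" for x :: "'a::real_inner"
  by (simp add: add_pos_nonneg)

lemma one_plus_inner_neq_0 [simp]: "1 + x \<bullet> x \<noteq> 0" for x :: "'a::real_inner"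
  using one_plus_inner_pos [of x] by linarith

lemma height_eq: "height x = conf x - 1" "1 - height x = conf x * (x \<bullet> x)"
  "1 - (height x)\<^sup>2 = (conf x * norm x)\<^sup>2"
proof -
  show 1: "height x = conf x - 1" and 2: "1 - height x = conf x * (x \<bullet> x)"
    by (simp_all add: height_def conf_def field_simps)
  have "1 - (height x)\<^sup>2 = (1 + height x) * (1 - height x)"
    by (simp add: algebra_simps power2_eq_square)
  then show "1 - (height x)\<^sup>2 = (conf x * norm x)\<^sup>2"
    unfolding 2 by (simp add: 1 dot_square_norm power_mult_distrib power2_eq_square)
qed

lemma conf_half: "conf x / 2 = 1 / (1 + x \<bullet> x)"
proof -
  have "2 / r / 2 = 1 / r" for r :: real by simp
  then show ?thesis unfolding conf_def .
qed

text \<open>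
  The cross terms cancel: Clifford multiplication is Hermitian, and its factor \<open>\<i>\<close> makes the product
  of the two components purely imaginary.
\<close>

lemma norm_zonal_field:
  assumes \<gamma>: "gamma_matrices \<gamma>"
  shows "(norm (zonal_field \<gamma> p v x))\<^sup>2 = zonal_energy p (height x) / 2 * (norm v)\<^sup>2"
proof -
  define a b where "a = poly p (height x)" and "b = poly p (- height x)"
  define w where "w = clifford \<gamma> x *v (\<i> *s v)"
  have w: "cinner w v = - cinner v w" "cinner w w = (x \<bullet> x) *\<^sub>R cinner v v"
  proof -
    have "w = \<i> *s (clifford \<gamma> x *v v)" by (simp add: w_def vector_scalar_commute)
    then show "cinner w v = - cinner v w" "cinner w w = (x \<bullet> x) *\<^sub>R cinner v v"
      by (simp_all add: cinner_scale cinner_clifford [OF \<gamma>] clifford_square [OF \<gamma>] cinner.scaleR_right)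
  qed
  have "complex_of_real ((norm (a *\<^sub>R v + b *\<^sub>R w))\<^sup>2) = complex_of_real ((a\<^sup>2 + b\<^sup>2 * (x \<bullet> x)) * (norm v)\<^sup>2)"
    unfolding cinner_self [symmetric]
    by (simp add: cinner.add_left cinner.add_right cinner.scaleR_left cinner.scaleR_right w scaleR_conv_of_real [where 'a = complex])
      (simp add: cinner_self algebra_simps power2_eq_square)
  then have n: "(norm (a *\<^sub>R v + b *\<^sub>R w))\<^sup>2 = (a\<^sup>2 + b\<^sup>2 * (x \<bullet> x)) * (norm v)\<^sup>2"
    using of_real_eq_iff by blast
  have "(norm (zonal_field \<gamma> p v x))\<^sup>2 = conf x / 2 * ((a\<^sup>2 + b\<^sup>2 * (x \<bullet> x)) * (norm v)\<^sup>2)"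
    unfolding n [symmetric]
    by (simp add: zonal_field_def a_def b_def w_def power_mult_distrib power_divide conf_half)
  also have "\<dots> = zonal_energy p (height x) / 2 * (norm v)\<^sup>2"
  proof -
    have "1 + height x = conf x" by (simp add: height_eq(1))
    then show ?thesis
      unfolding zonal_energy_def a_def [symmetric] b_def [symmetric] height_eq(2)
      by (simp add: algebra_simps)
  qed
  finally show ?thesis .
qed

lemma reflect_reflect_inner: "reflect k x \<bullet> reflect k x = x \<bullet> x"
  unfolding inner_vec_def reflect_def by (rule sum.cong) auto

lemma gamma_clifford_reflect:
  assumes \<gamma>: "gamma_matrices \<gamma>"
  shows "clifford \<gamma> (reflect k x) *v (\<gamma> k *v u) = - (\<gamma> k *v (clifford \<gamma> x *v u))"
proof -
  have "reflect k x $ a *\<^sub>R (\<gamma> a *v (\<gamma> k *v u)) = - (x $ a *\<^sub>R (\<gamma> k *v (\<gamma> a *v u)))" for a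
    using gamma_anticommute [OF \<gamma>, of a k u]
    by (cases "a = k") (auto simp: reflect_def add_eq_0_iff2)
  then show ?thesis
    by (simp add: clifford_apply matrix_vector_sum matrix_vector_scaleR sum_negf)
qed

lemma clifford_scaleR: "clifford \<gamma> (c *\<^sub>R x) = c *\<^sub>R clifford \<gamma> x"
  by (simp add: clifford_def scaleR_sum_right)

lemma clifford_axis: "clifford \<gamma> (axis a 1) = \<gamma> a"
proof -
  have "axis a 1 $ b *\<^sub>R \<gamma> b = (if b = a then \<gamma> a else 0)" for b
    by (simp add: axis_def)
  then show ?thesis by (simp add: clifford_def)
qed

lemma zonal_spinor_transition:
  assumes \<gamma>: "gamma_matrices \<gamma>" and x: "x \<noteq> 0"
  shows "zonal_spinor \<gamma> k p v South (transition k x) = (\<gamma> k ** clifford \<gamma> (sgn x)) *v zonal_spinor \<gamma> k p v North x"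
proof -
  define s where "s = x \<bullet> x"
  have s: "s > 0" using x by (simp add: s_def)
  have n: "norm x = sqrt s" by (simp add: s_def norm_eq_sqrt_inner)
  define y where "y = transition k x"
  have yy: "y \<bullet> y = 1 / s"
    using s by (simp add: y_def transition_def reflect_reflect_inner s_def)
  have h: "height y = - height x"
    using s by (simp add: height_def yy s_def [symmetric] divide_simps)
  have r: "1 / sqrt (1 + y \<bullet> y) = sqrt s / sqrt (1 + s)"
  proof -
    have "1 + 1 / s = (1 + s) / s" using s by (simp add: field_simps)
    then show ?thesis by (simp add: yy real_sqrt_divide)
  qed
  have cy: "clifford \<gamma> y *v (\<i> *s (\<gamma> k *v (\<i> *s v))) = (1 / s) *\<^sub>R (\<gamma> k *v (clifford \<gamma> x *v v))"
  proof -
    have "\<i> *s (\<gamma> k *v (\<i> *s v)) = \<gamma> k *v (- v)"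
      by (simp add: vector_scalar_commute [symmetric] vector_smult_assoc vec_eq_iff matrix_vector_mult_def sum_negf sum_distrib_left mult_ac)
    then show ?thesis
      by (simp add: y_def transition_def clifford_scaleR matrix_vector_scaleR gamma_clifford_reflect [OF \<gamma>] s_def)
        (simp add: vec_eq_iff matrix_vector_mult_def sum_negf)
  qed
  define a b where "a = poly p (height x)" and "b = poly p (- height x)"
  define u where "u = \<gamma> k *v (clifford \<gamma> x *v v)"
  define w where "w = \<gamma> k *v (\<i> *s v)"
  have "zonal_spinor \<gamma> k p v South y = (sqrt s / sqrt (1 + s)) *\<^sub>R (b *\<^sub>R w + (a / s) *\<^sub>R u)"
    by (simp add: zonal_field_def r h cy a_def b_def u_def w_def)
  also have "\<dots> = (1 / (sqrt s * sqrt (1 + s))) *\<^sub>R (a *\<^sub>R u + (b * s) *\<^sub>R w)"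
  proof -
    have "sqrt s / sqrt (1 + s) * (a / s) = a / (sqrt s * sqrt (1 + s))"
      "sqrt s / sqrt (1 + s) * b = b * s / (sqrt s * sqrt (1 + s))"
      using s by (simp_all add: field_simps)
    then show ?thesis by (simp add: scaleR_add_right add.commute)
  qed
  also have "\<dots> = (\<gamma> k ** clifford \<gamma> (sgn x)) *v zonal_spinor \<gamma> k p v North x"
    by (simp add: zonal_field_def sgn_div_norm clifford_scaleR n matrix_vector_mul_assoc [symmetric]
        matrix_vector_scaleR matrix_vector_right_distrib clifford_square [OF \<gamma>] a_def b_def u_def w_def s_def [symmetric]
        scaleR_add_right divide_inverse mult_ac)
  finally show ?thesis by (simp add: y_def)
qed

lemma zonal_field_dirac:
  fixes \<gamma> :: "'d::finite \<Rightarrow> complex ^ 'n ^ 'n::finite"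
  assumes \<gamma>: "gamma_matrices \<gamma>" and p: "zonal_profile (real CARD('d) / 2) l p"
    and u: "u c = zonal_field \<gamma> p v"
  shows "dirac \<gamma> k u c x = complex_of_real l *s u c x"
proof -
  define s where "s = x \<bullet> x"
  define z where "z = height x"
  define N where "N = 1 / sqrt (1 + s)"
  define P Q P' Q' where "P = poly p z" and "Q = poly p (- z)" and "P' = poly (pderiv p) z"
    and "Q' = - poly (pderiv p) (- z)"
  define h where "h = real CARD('d) / 2"
  define w where "w = \<i> *s v"
  define \<alpha> where "\<alpha> = N * (- (conf x)\<^sup>2 * P' - conf x / 2 * P)"
  define \<beta> where "\<beta> = N * (- (conf x)\<^sup>2 * Q' - conf x / 2 * Q)"
  have z': "(height has_derivative (\<lambda>t. - (conf x)\<^sup>2 * (x \<bullet> t))) (at x)"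
    unfolding height_eq(1) [abs_def] by (rule derivative_eq_intros refl ext | simp)+
  have N': "((\<lambda>x. 1 / sqrt (1 + x \<bullet> x)) has_derivative (\<lambda>t. - N * (conf x / 2) * (x \<bullet> t))) (at x)"
  proof -
    have "((\<lambda>r. 1 / sqrt r) has_real_derivative - (1 / (2 * sqrt r)) / r) (at r)" if "r > 0" for r
      using that by (auto intro!: derivative_eq_intros simp: field_simps)
    moreover have "- (1 / (2 * a)) / r = - (1 / a) * (1 / r / 2)" for a r :: real
      by simp
    moreover have "conf x / 4 = 1 / (1 + x \<bullet> x) / 2"
      using arg_cong [OF conf_half [of x], of "\<lambda>r. r / 2"] by (simp only: divide_divide_eq_left)
    ultimately have D: "((\<lambda>r. 1 / sqrt r) has_real_derivative - N * (conf x / 4)) (at (1 + x \<bullet> x))"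
      unfolding N_def s_def by (metis one_plus_inner_pos)
    have "((\<lambda>x. 1 + x \<bullet> x) has_derivative (\<lambda>t. 2 * (x \<bullet> t))) (at x)"
      by (rule derivative_eq_intros refl ext | simp add: inner_commute)+
    from has_derivative_compose [OF this D [unfolded has_field_derivative_def]] show ?thesis
      by (rule has_derivative_eq_rhs) (simp add: fun_eq_iff)
  qed
  have P: "((\<lambda>x. poly p (height x)) has_derivative (\<lambda>t. P' * (- (conf x)\<^sup>2 * (x \<bullet> t)))) (at x)"
    using has_derivative_compose [OF z' poly_DERIV [of p "height x", unfolded has_field_derivative_def]]
    by (simp add: P'_def z_def)
  have Q: "((\<lambda>x. poly p (- height x)) has_derivative (\<lambda>t. Q' * (- (conf x)\<^sup>2 * (x \<bullet> t)))) (at x)"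
    using has_derivative_compose [OF z' poly_minus_DERIV [of p "height x", unfolded has_field_derivative_def]]
    by (simp add: Q'_def z_def)
  have C: "((\<lambda>x. clifford \<gamma> x *v w) has_derivative (\<lambda>t. clifford \<gamma> t *v w)) (at x)"
    unfolding clifford_apply
    by (intro has_derivative_sum has_derivative_scaleR_left bounded_linear_imp_has_derivative bounded_linear_vec_nth)
  have "(zonal_field \<gamma> p v has_derivative (\<lambda>t. ((x \<bullet> t) * \<alpha>) *\<^sub>R v + ((x \<bullet> t) * \<beta>) *\<^sub>R (clifford \<gamma> x *v w)
      + (N * Q) *\<^sub>R (clifford \<gamma> t *v w))) (at x)"
    unfolding zonal_field_def [abs_def] w_def [symmetric]
    by (rule has_derivative_eq_rhs [OF has_derivative_scaleR [OF N' has_derivative_add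
        [OF has_derivative_scaleR [OF P has_derivative_const] has_derivative_scaleR [OF Q C]]]])
      (simp add: fun_eq_iff vec_eq_iff scaleR_conv_of_real [where 'a = complex] \<alpha>_def \<beta>_def N_def s_def P_def Q_def z_def algebra_simps)
  from pderiv_vec_eq [OF this]
  have pd: "pderiv_vec a (u c) x = (x $ a * \<alpha>) *\<^sub>R v + (x $ a * \<beta>) *\<^sub>R (clifford \<gamma> x *v w) + (N * Q) *\<^sub>R (\<gamma> a *v w)" for a
    by (simp add: u inner_axis clifford_axis)
  have "(\<Sum>a\<in>UNIV. \<gamma> a *v pderiv_vec a (u c) x)
      = \<alpha> *\<^sub>R (clifford \<gamma> x *v v) + \<beta> *\<^sub>R (clifford \<gamma> x *v (clifford \<gamma> x *v w)) + (2 * h * N * Q) *\<^sub>R w"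
    by (simp add: pd matrix_vector_right_distrib matrix_vector_scaleR gamma_square [OF \<gamma>] sum.distrib
        h_def clifford_apply [of \<gamma> x v] clifford_apply [of \<gamma> x "clifford \<gamma> x *v w"] scaleR_sum_right sum_constant_scaleR mult_ac
        del: sum_constant)
  also have "\<dots> = \<alpha> *\<^sub>R (clifford \<gamma> x *v v) + (\<beta> * s + 2 * h * N * Q) *\<^sub>R w"
    by (simp add: clifford_square [OF \<gamma>] s_def scaleR_add_left)
  finally have G: "(\<Sum>a\<in>UNIV. \<gamma> a *v pderiv_vec a (u c) x) = \<dots>" .
  have uc: "u c x = (N * P) *\<^sub>R v + (N * Q) *\<^sub>R (clifford \<gamma> x *v w)"
    by (simp add: u zonal_field_def N_def P_def Q_def s_def z_def w_def scaleR_add_right)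
  have F: "clifford \<gamma> x *v u c x = (N * P) *\<^sub>R (clifford \<gamma> x *v v) + (N * Q * s) *\<^sub>R w"
    by (simp add: uc matrix_vector_right_distrib matrix_vector_scaleR clifford_square [OF \<gamma>] s_def)
  have e1: "(1 / conf x) * \<alpha> - (2 * h - 1) / 2 * (N * P) = - (N * l * Q)"
  proof -
    have f1: "conf x * P' = l * Q - h * P"
      using zonal_profileD(1) [OF p, of z] by (simp add: P_def Q_def P'_def h_def z_def height_eq)
    have f2: "(1 / conf x) * \<alpha> = N * (- (conf x * P') - P / 2)"
      by (simp add: \<alpha>_def power2_eq_square field_simps)
    show ?thesis unfolding f2 f1 by (simp add: field_simps)
  qed
  have e2: "(1 / conf x) * (\<beta> * s + 2 * h * N * Q) - (2 * h - 1) / 2 * (N * Q * s) = N * l * P"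
  proof -
    have f1: "conf x * s * Q' = h * Q - l * P"
      using zonal_profileD(2) [OF p, of z] height_eq(2) [of x] by (simp add: P_def Q_def Q'_def h_def z_def s_def)
    have f2: "(1 / conf x) * (\<beta> * s) = N * (- (conf x * s * Q') - s * Q / 2)"
      by (simp add: \<beta>_def power2_eq_square field_simps)
    have f3: "(1 / conf x) * (2 * h * N * Q) = h * N * Q * (1 + s)"
      by (simp add: conf_def s_def)
    show ?thesis unfolding distrib_left [of "1 / conf x"] f2 f3 f1 by (simp add: field_simps)
  qed
  have "dirac \<gamma> k u c x = (- \<i>) *s (((1 / conf x) * \<alpha> - (2 * h - 1) / 2 * (N * P)) *\<^sub>R (clifford \<gamma> x *v v)
      + ((1 / conf x) * (\<beta> * s + 2 * h * N * Q) - (2 * h - 1) / 2 * (N * Q * s)) *\<^sub>R w)"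
    unfolding dirac_eq [OF \<gamma>] G F
    by (simp add: h_def scaleR_add_right scaleR_diff_left scaleR_diff_right algebra_simps)
  also have "\<dots> = complex_of_real l *s u c x"
    unfolding e1 e2 uc
    by (simp add: w_def vector_scalar_commute vec_eq_iff scaleR_conv_of_real [where 'a = complex] algebra_simps)
  finally show ?thesis .
qed

text \<open>
  A class of functions that contains the components of zonal spinors and is closed under partial
  derivatives, so that all its members are smooth.
\<close>

inductive elementary :: "(real ^ 'd::finite \<Rightarrow> 'b::real_normed_vector) \<Rightarrow> bool" where
  base: "elementary (\<lambda>x. (1 + x \<bullet> x) powr r *\<^sub>R v)"
| coord: "elementary f \<Longrightarrow> elementary (\<lambda>x. x $ i *\<^sub>R f x)"
| add: "elementary f \<Longrightarrow> elementary g \<Longrightarrow> elementary (\<lambda>x. f x + g x)"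

lemma elementary_const: "elementary (\<lambda>x. v)"
  using elementary.base [of 0 v] by simp

lemma elementary_powr: "elementary f \<Longrightarrow> elementary (\<lambda>x. (1 + x \<bullet> x) powr r *\<^sub>R f x)"
proof (induction rule: elementary.induct)
  case (base a v)
  then show ?case using elementary.base [of "r + a" v] by (simp add: powr_add)
next
  case (coord f i)
  then show ?case using elementary.coord [OF coord.IH, of i] by (simp add: mult.commute)
next
  case (add f g)
  then show ?case using elementary.add by (simp add: scaleR_add_right)
qed

lemma elementary_scaleR: "elementary f \<Longrightarrow> elementary (\<lambda>x. c *\<^sub>R f x)"
proof (induction rule: elementary.induct)
  case (base a v)
  then show ?case using elementary.base [of a "c *\<^sub>R v"] by (simp add: mult.commute)
next
  case (coord f i)
  then show ?case using elementary.coord [OF coord.IH, of i] by (simp add: mult.commute)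
next
  case (add f g)
  then show ?case using elementary.add by (simp add: scaleR_add_right)
qed

lemma elementary_sum:
  assumes "\<And>a. a \<in> S \<Longrightarrow> elementary (f a)"
  shows "elementary (\<lambda>x. \<Sum>a\<in>S. f a x)"
  using assms
  by (induction S rule: infinite_finite_induct) (simp_all add: elementary_const elementary.add)

lemma elementary_derivative:
  assumes "elementary f"
  shows "(\<forall>x. f differentiable (at x)) \<and> (\<forall>j. elementary (pderiv_vec j f))"
  using assms
proof (induction rule: elementary.induct)
  case (base r v)
  have D: "((\<lambda>x. (1 + x \<bullet> x) powr r *\<^sub>R v) has_derivative (\<lambda>t. (2 * r * (x \<bullet> t) * (1 + x \<bullet> x) powr (r - 1)) *\<^sub>R v)) (at x)"
    for x :: "real ^ 'a"
  proof -
    have 1: "((\<lambda>x. 1 + x \<bullet> x) has_derivative (\<lambda>t. 2 * (x \<bullet> t))) (at x)"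
      by (rule derivative_eq_intros refl ext | simp add: inner_commute)+
    have 2: "((\<lambda>y. y powr r) has_real_derivative r * (1 + x \<bullet> x) powr (r - 1)) (at (1 + x \<bullet> x))"
      by (rule has_real_derivative_powr) simp
    from has_derivative_compose [OF 1 2 [unfolded has_field_derivative_def]]
    have "((\<lambda>x. (1 + x \<bullet> x) powr r) has_derivative (\<lambda>t. 2 * r * (x \<bullet> t) * (1 + x \<bullet> x) powr (r - 1))) (at x)"
      by (rule has_derivative_eq_rhs) (simp add: fun_eq_iff)
    then show ?thesis by (rule has_derivative_scaleR_left)
  qed
  have "pderiv_vec j (\<lambda>x. (1 + x \<bullet> x) powr r *\<^sub>R v) = (\<lambda>x. x $ j *\<^sub>R ((1 + x \<bullet> x) powr (r - 1) *\<^sub>R ((2 * r) *\<^sub>R v)))"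
    for j :: 'a
    by (rule ext, subst pderiv_vec_eq [OF D]) (simp add: inner_axis mult_ac)
  moreover have "elementary (\<lambda>x. x $ j *\<^sub>R ((1 + x \<bullet> x) powr (r - 1) *\<^sub>R ((2 * r) *\<^sub>R v)))" for j :: 'a
    by (intro elementary.intros)
  ultimately show ?case
    using D by (simp only:) (auto simp: differentiable_def)
next
  case (coord f i)
  have D: "((\<lambda>x. x $ i *\<^sub>R f x) has_derivative
      (\<lambda>t. x $ i *\<^sub>R frechet_derivative f (at x) t + t $ i *\<^sub>R f x)) (at x)" for x
    using coord.IH
    by (intro has_derivative_scaleR bounded_linear_imp_has_derivative [OF bounded_linear_vec_nth])
      (auto simp: frechet_derivative_works [symmetric])
  have "pderiv_vec j (\<lambda>x. x $ i *\<^sub>R f x) = (\<lambda>x. x $ i *\<^sub>R pderiv_vec j f x + (if i = j then 1 else 0) *\<^sub>R f x)" for j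
    by (rule ext, subst pderiv_vec_eq [OF D]) (simp add: pderiv_vec_def axis_def)
  then show ?case
    using D coord by (auto simp: differentiable_def intro!: elementary.intros elementary_scaleR simp del: if_split)
next
  case (add f g)
  have D: "((\<lambda>x. f x + g x) has_derivative
      (\<lambda>t. frechet_derivative f (at x) t + frechet_derivative g (at x) t)) (at x)" for x
    using add.IH by (intro has_derivative_add) (auto simp: frechet_derivative_works [symmetric])
  have "pderiv_vec j (\<lambda>x. f x + g x) = (\<lambda>x. pderiv_vec j f x + pderiv_vec j g x)" for j
    by (rule ext, subst pderiv_vec_eq [OF D]) (simp add: pderiv_vec_def)
  then show ?case
    using D add by (auto simp: differentiable_def intro!: elementary.intros)
qed

lemma elementary_smooth:
  fixes f :: "real ^ 'd::finite \<Rightarrow> 'b::real_normed_vector"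
  shows "elementary f \<Longrightarrow> smooth f"
proof -
  have *: "elementary f \<Longrightarrow> C_k m f" for m and f :: "real ^ 'd \<Rightarrow> 'b"
  proof (induction m arbitrary: f)
    case 0
    then have "continuous (at x) f" for x
      using elementary_derivative [OF 0] by (auto intro: differentiable_imp_continuous_within)
    then show ?case by (simp add: continuous_at_imp_continuous_on)
  next
    case (Suc m)
    then show ?case using elementary_derivative by auto
  qed
  then show "elementary f \<Longrightarrow> smooth f" unfolding smooth_def by (intro allI *)
qed

lemma elementary_poly_height: "elementary f \<Longrightarrow> elementary (\<lambda>x. poly p (height x) *\<^sub>R f x)"
proof (induction p)
  case 0
  then show ?case by (simp add: elementary_const)
next
  case (pCons c p)
  have "elementary (\<lambda>x. height x *\<^sub>R g x)" if g: "elementary g" for g :: "real ^ 'a \<Rightarrow> 'b"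
  proof -
    have "elementary (\<lambda>x. 2 *\<^sub>R ((1 + x \<bullet> x) powr (- 1) *\<^sub>R g x) + (- 1) *\<^sub>R g x)"
      by (intro elementary.add elementary_scaleR elementary_powr g)
    then show ?thesis
      by (simp add: height_eq(1) conf_def powr_minus divide_inverse scaleR_diff_left less_imp_le)
  qed
  from elementary.add [OF elementary_scaleR [OF pCons.prems] this [OF pCons.IH [OF pCons.prems]], of c]
  show ?case by (simp add: scaleR_add_left)
qed

lemma smooth_zonal_field: "smooth (zonal_field \<gamma> p v)"
proof (rule elementary_smooth)
  have 1: "elementary (\<lambda>x. clifford \<gamma> x *v w)" for w
    unfolding clifford_apply by (intro elementary_sum elementary.coord elementary_const)
  have "poly p (- t) = poly (pcompose p [:0, -1:]) t" for t
    by (simp add: poly_pcompose)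
  then have "elementary (\<lambda>x. (1 + x \<bullet> x) powr (- 1 / 2) *\<^sub>R
     (poly p (height x) *\<^sub>R v + poly p (- height x) *\<^sub>R (clifford \<gamma> x *v (\<i> *s v))))"
    by (simp only:) (intro elementary_powr elementary.add elementary_poly_height elementary_const 1)
  moreover have "(1 + x \<bullet> x) powr (- 1 / 2) = 1 / sqrt (1 + x \<bullet> x)" for x :: "real ^ 'a"
    using powr_minus_divide [of "1 + x \<bullet> x" "1 / 2"] by (simp add: powr_half_sqrt less_imp_le)
  ultimately show "elementary (zonal_field \<gamma> p v)"
    unfolding zonal_field_def [abs_def] by simp
qed

lemma zonal_spinor_smooth:
  assumes "gamma_matrices \<gamma>"
  shows "zonal_spinor \<gamma> k p v \<in> smooth_spinors \<gamma> k"
  using zonal_spinor_transition [OF assms] by (simp add: smooth_spinors_def smooth_zonal_field)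

lemma zonal_spinor_eigenspinor:
  fixes \<gamma> :: "'d::finite \<Rightarrow> complex ^ 'n ^ 'n::finite"
  assumes \<gamma>: "gamma_matrices \<gamma>" and p: "zonal_profile (real CARD('d) / 2) l p"
  shows "zonal_spinor \<gamma> k p v \<in> eigenspinors \<gamma> k l"
proof -
  have "dirac \<gamma> k (zonal_spinor \<gamma> k p v) c x = complex_of_real l *s zonal_spinor \<gamma> k p v c x" for c x
  proof (cases c)
    case North
    then show ?thesis
      by (intro zonal_field_dirac [OF \<gamma> p, where v = v]) simp
  next
    case South
    then show ?thesis
      by (intro zonal_field_dirac [OF \<gamma> p, where v = "\<gamma> k *v (\<i> *s v)"]) simp
  qed
  then show ?thesis
    using zonal_spinor_smooth [OF \<gamma>] by (simp add: eigenspinors_def fun_eq_iff)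
qed

lemma zonal_spinor_scale: "zonal_spinor \<gamma> k p (c *s v) = (\<lambda>e x. c *s zonal_spinor \<gamma> k p v e x)"
proof (intro ext)
  fix e x
  have *: "zonal_field \<gamma> p (c *s w) x = c *s zonal_field \<gamma> p w x" for w
  proof -
    have "clifford \<gamma> x *v (\<i> *s (c *s w)) = c *s (clifford \<gamma> x *v (\<i> *s w))"
      by (simp add: vector_scalar_commute [symmetric] vector_smult_assoc mult.commute)
    then show ?thesis
      by (simp add: zonal_field_def vec_eq_iff scaleR_conv_of_real [where 'a = complex] algebra_simps)
  qed
  have "\<gamma> k *v (\<i> *s (c *s v)) = c *s (\<gamma> k *v (\<i> *s v))"
    by (simp add: vector_scalar_commute [symmetric] vector_smult_assoc mult.commute)
  then show "zonal_spinor \<gamma> k p (c *s v) e x = c *s zonal_spinor \<gamma> k p v e x"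
    by (cases e) (simp_all add: *)
qed

section \<open>The stereographic volume weight\<close>

lemma conf_continuous [continuous_intros]: "continuous_on S conf"
  unfolding conf_def [abs_def] by (intro continuous_intros) auto

lemma conf_measurable [measurable]: "conf \<in> borel_measurable borel"
  by (intro borel_measurable_continuous_onI continuous_intros)

lemma conf_bounds: "conf x \<le> 2" "conf x * norm x \<le> 1" "conf x * (norm x)\<^sup>2 \<le> 2"
proof -
  have r: "1 + x \<bullet> x = 1 + (norm x)\<^sup>2" by (simp add: dot_square_norm)
  have p: "1 + (norm x)\<^sup>2 > 0" by (simp add: add_pos_nonneg)
  show "conf x \<le> 2" "conf x * (norm x)\<^sup>2 \<le> 2"
    using p unfolding conf_def r by (simp_all add: field_simps)
  show "conf x * norm x \<le> 1"
    using p sum_squares_bound [of 1 "norm x"] unfolding conf_def r by (simp add: field_simps)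
qed

text \<open>
  On the shell where \<open>norm x\<close> is about \<open>2 ^ (- j)\<close>, or about \<open>2 ^ j\<close>, the weight is bounded by
  the constants below, and the products of these constants with the volumes of the balls decay like
  \<open>2 ^ (- j)\<close>.
\<close>

lemma conf_weight_dyadic:
  fixes x :: "'a::real_inner"
  assumes D: "D > 0"
  shows "\<exists>j. conf x / norm x ^ D \<le> 2 * 2 ^ (Suc j * D) * indicator (cball 0 ((1/2) ^ j)) x
     + 2 * (1/2) ^ (j * (D + 2)) * indicator (cball 0 (2 ^ Suc j)) x"
proof -
  consider "x = 0" | "0 < norm x" "norm x \<le> 1" | "norm x > 1" by fastforce
  then show ?thesis
  proof cases
    case 1
    then show ?thesis using D by (simp add: power_0_left)
  next
    case 2
    have ex: "\<exists>n. (1/2) ^ n < norm x" using real_arch_pow_inv [of "norm x" "1/2"] 2 by simp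
    define n where "n = (LEAST n. (1/2) ^ n < norm x)"
    have n: "(1/2) ^ n < norm x" using LeastI_ex [OF ex] by (simp add: n_def)
    have "n \<noteq> 0"
    proof
      assume "n = 0"
      then show False using n 2 by simp
    qed
    then obtain j where j: "n = Suc j" using not0_implies_Suc by blast
    have "\<not> (1/2) ^ j < norm x" using not_less_Least [of j "\<lambda>n. (1/2) ^ n < norm x"] by (simp add: n_def [symmetric] j)
    then have ind: "indicator (cball 0 ((1/2) ^ j)) x = (1 :: real)" by simp
    have "((1/2) ^ Suc j) ^ D \<le> norm x ^ D" using n j by (intro power_mono) auto
    then have "1 / norm x ^ D \<le> 1 / ((1/2) ^ Suc j) ^ D"
      using 2 by (intro divide_left_mono mult_pos_pos) auto
    also have "\<dots> = 2 ^ (Suc j * D)" by (simp only: power_mult [symmetric] power_one_over) simp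
    finally have b: "conf x * (1 / norm x ^ D) \<le> 2 * 2 ^ (Suc j * D)"
      using conf_bounds(1) [of x] by (intro mult_mono) auto
    have "0 \<le> 2 * (1/2 :: real) ^ (j * (D + 2)) * indicator (cball 0 (2 ^ Suc j)) x"
      by simp
    from add_increasing2 [OF this b] show ?thesis
      using ind by (intro exI [of _ j]) (simp only: mult_1_right times_divide_eq_right)
  next
    case 3
    have ex: "\<exists>n. norm x < 2 ^ n" using real_arch_pow [of 2 "norm x"] by simp
    define n where "n = (LEAST n. norm x < 2 ^ n)"
    have n: "norm x < 2 ^ n" using LeastI_ex [OF ex] by (simp add: n_def)
    have "n \<noteq> 0"
    proof
      assume "n = 0"
      then show False using n 3 by simp
    qed
    then obtain j where j: "n = Suc j" using not0_implies_Suc by blast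
    have "\<not> norm x < 2 ^ j" using not_less_Least [of j "\<lambda>n. norm x < 2 ^ n"] by (simp add: n_def [symmetric] j)
    then have "(2 ^ j) ^ (D + 2) \<le> norm x ^ (D + 2)" by (intro power_mono) auto
    moreover have "0 < norm x ^ (D + 2)" "(0 :: real) < (2 ^ j) ^ (D + 2)"
      using 3 by (auto intro!: zero_less_power simp del: power_Suc)
    ultimately have "1 / norm x ^ (D + 2) \<le> 1 / (2 ^ j) ^ (D + 2)"
      by (intro divide_left_mono mult_pos_pos) (assumption | simp)+
    also have "\<dots> = (1/2) ^ (j * (D + 2))" by (simp only: power_mult power_one_over)
    finally have "conf x * (norm x)\<^sup>2 * (1 / norm x ^ (D + 2)) \<le> 2 * (1/2) ^ (j * (D + 2))"
      using conf_bounds(3) [of x] by (intro mult_mono) auto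
    moreover have "conf x * (norm x)\<^sup>2 * (1 / norm x ^ (D + 2)) = conf x / norm x ^ D"
    proof -
      have "x \<noteq> 0" using 3 by auto
      then show ?thesis by (simp add: power_add power2_eq_square)
    qed
    ultimately have b: "conf x / norm x ^ D \<le> 2 * (1/2) ^ (j * (D + 2))" by simp
    have ind: "indicator (cball 0 (2 ^ Suc j)) x = (1 :: real)" using n j by simp
    have "0 \<le> 2 * 2 ^ (Suc j * D) * (indicator (cball 0 ((1/2) ^ j)) x :: real)"
      by simp
    from add_increasing [OF this b] show ?thesis
      by (intro exI [of _ j]) (simp only: ind mult_1_right)
  qed
qed

text \<open>
  This weight is the density, in the chart, of the bound that the energy decay gives for the square of a
  zonal spinor.
\<close>

lemma integrable_conf_weight:
  assumes D: "DIM('a::euclidean_space) = Suc D" "D > 0"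
  shows "integrable lborel (\<lambda>x :: 'a. conf x / norm x ^ D)"
proof (rule integrableI_bounded)
  show "(\<lambda>x :: 'a. conf x / norm x ^ D) \<in> borel_measurable lborel"
    by measurable
  define V where "V = unit_ball_vol (DIM('a))"
  have V: "V \<ge> 0" by (simp add: V_def)
  define T where "T j x = 2 * 2 ^ (Suc j * D) * indicator (cball 0 ((1/2) ^ j)) x
     + 2 * (1/2) ^ (j * (D + 2)) * (indicator (cball 0 (2 ^ Suc j)) x :: real)" for j and x :: 'a
  have [measurable]: "cball c r \<in> sets borel" for c :: 'a and r
    by (intro borel_closed closed_cball)
  have "ennreal (norm (conf x / norm x ^ D)) \<le> (\<Sum>j. ennreal (T j x))" for x :: 'a
  proof -
    obtain j where "conf x / norm x ^ D \<le> T j x"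
      using conf_weight_dyadic [OF D(2), of x] unfolding T_def by blast
    then have "ennreal (norm (conf x / norm x ^ D)) \<le> ennreal (T j x)"
      using conf_pos [of x] by (intro ennreal_leI) (simp add: abs_of_pos)
    also have "\<dots> = (\<Sum>i\<in>{j}. ennreal (T i x))" by simp
    also have "\<dots> \<le> (\<Sum>j. ennreal (T j x))"
      by (rule sum_le_suminf) auto
    finally show ?thesis .
  qed
  then have "nn_integral lborel (\<lambda>x :: 'a. ennreal (norm (conf x / norm x ^ D))) \<le> (\<integral>\<^sup>+ x. (\<Sum>j. ennreal (T j x)) \<partial>lborel)"
    by (intro nn_integral_mono) auto
  also have "\<dots> = (\<Sum>j. \<integral>\<^sup>+ x. ennreal (T j x) \<partial>lborel)"
    unfolding T_def by (rule nn_integral_suminf) measurable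
  also have "\<dots> = (\<Sum>j. ennreal ((2 * 2 ^ D * V + 2 * 2 ^ Suc D * V) * (1/2) ^ j))"
  proof (rule suminf_cong)
    fix j
    have "(\<integral>\<^sup>+ x. ennreal (T j x) \<partial>lborel) =
      (\<integral>\<^sup>+ x. ennreal (2 * 2 ^ (Suc j * D)) * indicator (cball 0 ((1/2) ^ j)) x
         + ennreal (2 * (1/2) ^ (j * (D + 2))) * indicator (cball 0 (2 ^ Suc j) :: 'a set) x \<partial>lborel)"
      unfolding T_def by (intro nn_integral_cong) (simp add: indicator_def ennreal_plus)
    also have "\<dots> = ennreal (2 * 2 ^ (Suc j * D)) * ennreal (V * ((1/2) ^ j) ^ Suc D)
         + ennreal (2 * (1/2) ^ (j * (D + 2))) * ennreal (V * (2 ^ Suc j) ^ Suc D)"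
      by (subst nn_integral_add)
        (simp_all add: nn_integral_cmult emeasure_cball V_def D(1) del: power_Suc)
    also have "\<dots> = ennreal (2 * 2 ^ (Suc j * D) * (V * ((1/2) ^ j) ^ Suc D)
         + 2 * (1/2) ^ (j * (D + 2)) * (V * (2 ^ Suc j) ^ Suc D))"
    proof -
      have "ennreal a * ennreal b + ennreal c * ennreal e = ennreal (a * b + c * e)"
        if "0 \<le> a" "0 \<le> b" "0 \<le> c" "0 \<le> e" for a b c e
        using that by (simp add: ennreal_mult ennreal_plus)
      then show ?thesis using V by simp
    qed
    also have "2 * 2 ^ (Suc j * D) * (V * ((1/2) ^ j) ^ Suc D) = 2 * 2 ^ D * V * (1/2) ^ j"
    proof -
      have "(2::real) ^ (Suc j * D) * ((1/2) ^ j) ^ Suc D = 2 ^ D * (1/2) ^ j"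
        by (simp add: power_add power_mult [symmetric] power_divide field_simps)
      then show ?thesis by (simp add: mult_ac)
    qed
    also have "2 * (1/2) ^ (j * (D + 2)) * (V * (2 ^ Suc j) ^ Suc D) = 2 * 2 ^ Suc D * V * (1/2) ^ j"
    proof -
      have "(1/2 :: real) ^ (j * (D + 2)) * (2 ^ Suc j) ^ Suc D = 2 ^ Suc D * (1/2) ^ j"
        by (simp add: power_add power_mult [symmetric] power_divide power_mult_distrib field_simps)
      then show ?thesis by (simp add: mult_ac)
    qed
    finally show "(\<integral>\<^sup>+ x. ennreal (T j x) \<partial>lborel) = ennreal ((2 * 2 ^ D * V + 2 * 2 ^ Suc D * V) * (1/2) ^ j)"
      by (simp only: distrib_right)
  qed
  also have "\<dots> = ennreal ((2 * 2 ^ D * V + 2 * 2 ^ Suc D * V) * (\<Sum>j. (1/2) ^ j))"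
    using V by (intro suminf_ennreal_eq sums_mult summable_sums summable_geometric) auto
  also have "\<dots> < \<infinity>" by simp
  finally show "nn_integral lborel (\<lambda>x :: 'a. ennreal (norm (conf x / norm x ^ D))) < \<infinity>" .
qed

lemma integrable_conf_power:
  assumes D: "DIM('a::euclidean_space) = Suc D" "D \<ge> 2" and m: "m \<ge> D"
  shows "integrable lborel (\<lambda>x :: 'a. conf x ^ m)"
proof (rule Bochner_Integration.integrable_bound)
  show "integrable lborel (\<lambda>x :: 'a. 2 ^ Suc (m - D) * (conf x / norm x ^ D))"
    using integrable_conf_weight [OF D(1)] D(2) by (intro integrable_mult_right) auto
  show "AE x :: 'a in lborel. norm (conf x ^ m) \<le> norm (2 ^ Suc (m - D) * (conf x / norm x ^ D))"
  proof (rule AE_I' [of "{0}"])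
    have "conf x ^ m \<le> 2 ^ Suc (m - D) * (conf x / norm x ^ D)" if x: "x \<noteq> 0" for x :: 'a
    proof -
      have "conf x ^ D * norm x ^ D = conf x * (conf x * (norm x)\<^sup>2) * (conf x * norm x) ^ (D - 2)"
        using D(2) by (simp add: power_mult_distrib power2_eq_square power_add [symmetric] flip: power_Suc)
          (simp add: power_eq_if mult_ac numeral_2_eq_2)
      also have "\<dots> \<le> (conf x * 2) * 1"
        using conf_bounds [of x] by (intro mult_mono power_le_one) (auto simp: less_imp_le)
      finally have 1: "conf x ^ D \<le> 2 * (conf x / norm x ^ D)"
        using x by (simp add: field_simps)
      have "conf x ^ m = conf x ^ (m - D) * conf x ^ D"
        using m by (simp flip: power_add)
      also have "\<dots> \<le> 2 ^ (m - D) * (2 * (conf x / norm x ^ D))"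
        using 1 conf_bounds(1) [of x] by (intro mult_mono power_mono) (auto simp: less_imp_le)
      finally show ?thesis by (simp add: mult_ac)
    qed
    then show "{x \<in> space lborel. \<not> norm (conf x ^ m) \<le> norm (2 ^ Suc (m - D) * (conf x / norm x ^ D))} \<subseteq> {0 :: 'a}"
      by (force simp: abs_mult abs_of_pos less_imp_le)
  qed (simp add: null_sets_def)
qed measurable

section \<open>The divergence theorem on Euclidean space\<close>

lemma pderiv_vec_along_line:
  fixes Y :: "real ^ 'd::finite \<Rightarrow> 'b::real_normed_vector"
  assumes "Y differentiable (at (x + t *\<^sub>R axis a 1))"
  shows "((\<lambda>t. Y (x + t *\<^sub>R axis a 1)) has_derivative (\<lambda>s. s *\<^sub>R pderiv_vec a Y (x + t *\<^sub>R axis a 1))) (at t within S)"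
proof -
  let ?e = "axis a 1 :: real ^ 'd"
  have D: "(Y has_derivative frechet_derivative Y (at (x + t *\<^sub>R ?e))) (at (x + t *\<^sub>R ?e))"
    using assms by (simp add: frechet_derivative_works [symmetric])
  have "((\<lambda>t. x + t *\<^sub>R ?e) has_derivative (\<lambda>s. s *\<^sub>R ?e)) (at t within S)"
    by (auto intro!: derivative_eq_intros)
  from has_derivative_compose [OF this D]
  show ?thesis
    by (rule has_derivative_eq_rhs)
      (simp add: fun_eq_iff pderiv_vec_def linear_scale [OF has_derivative_linear [OF D]])
qed

text \<open>
  By translation invariance every difference quotient has integral zero, and the mean value
  inequality dominates the quotients by a multiple of the indicator function of a ball.
\<close>

lemma integral_pderiv_compact_support:
  fixes Y :: "real ^ 'd::finite \<Rightarrow> 'b::euclidean_space"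
  assumes diff: "\<And>x. Y differentiable (at x)"
    and cont: "continuous_on UNIV (pderiv_vec a Y)"
    and supp: "\<And>x. norm x > R \<Longrightarrow> Y x = 0"
  shows "(LINT x|lborel. pderiv_vec a Y x) = 0"
proof -
  let ?e = "axis a 1 :: real ^ 'd"
  define K where "K = cball (0 :: real ^ 'd) (R + 1)"
  have Ycont: "continuous_on UNIV Y"
    using diff by (intro continuous_at_imp_continuous_on) (auto intro: differentiable_imp_continuous_within)
  have [measurable]: "Y \<in> borel_measurable borel" "pderiv_vec a Y \<in> borel_measurable borel"
    by (intro borel_measurable_continuous_onI Ycont cont)+
  have Yint: "integrable lborel Y"
  proof -
    have "integrable lborel (\<lambda>x. indicator (cball 0 R) x *\<^sub>R Y x)"
      by (intro borel_integrable_compact continuous_on_subset [OF Ycont]) auto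
    moreover have "indicator (cball 0 R) x *\<^sub>R Y x = Y x" for x
      using supp [of x] by (auto simp: indicator_def)
    ultimately show ?thesis by simp
  qed
  obtain M where M: "\<And>x. x \<in> cball 0 (R + 2) \<Longrightarrow> norm (pderiv_vec a Y x) \<le> M"
  proof -
    have "bounded (pderiv_vec a Y ` cball 0 (R + 2))"
      by (intro compact_imp_bounded compact_continuous_image continuous_on_subset [OF cont]) auto
    then obtain M where "\<forall>x\<in>cball 0 (R + 2). norm (pderiv_vec a Y x) \<le> M"
      by (auto simp: bounded_iff)
    then show ?thesis using that by blast
  qed
  define M' where "M' = max M 0"
  define g where "g n x = real (Suc n) *\<^sub>R (Y (x + (1 / real (Suc n)) *\<^sub>R ?e) - Y x)" for n x
  have g_int: "integral\<^sup>L lborel (g n) = 0" for n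
  proof -
    let ?c = "(1 / real (Suc n)) *\<^sub>R ?e"
    have "integral\<^sup>L (distr lborel borel ((+) ?c)) Y = integral\<^sup>L lborel (\<lambda>x. Y (?c + x))"
      by (rule integral_distr) auto
    then have "integral\<^sup>L lborel (\<lambda>x. Y (x + ?c)) = integral\<^sup>L lborel Y"
      unfolding lborel_distr_plus by (simp add: add.commute)
    moreover have "integrable lborel (\<lambda>x. Y (x + ?c))"
    proof -
      have "integrable (distr lborel borel ((+) ?c)) Y"
        unfolding lborel_distr_plus by (rule Yint)
      from integrable_distr [OF _ this] show ?thesis by (simp add: add.commute)
    qed
    ultimately show ?thesis
      unfolding g_def using Yint by (simp add: Bochner_Integration.integral_diff)
  qed
  have "(\<lambda>n. integral\<^sup>L lborel (g n)) \<longlonglongrightarrow> (LINT x|lborel. pderiv_vec a Y x)"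
  proof (rule integral_dominated_convergence)
    show "integrable lborel (\<lambda>x. M' * indicator K x)"
      by (auto simp: K_def intro!: integrable_real_mult_indicator integrable_mult_right integrable_real_indicator emeasure_bounded_finite bounded_cball)
    show "AE x in lborel. (\<lambda>n. g n x) \<longlonglongrightarrow> pderiv_vec a Y x"
    proof (rule AE_I2)
      fix x
      define v where "v = pderiv_vec a Y x"
      have "((\<lambda>t. Y (x + t *\<^sub>R ?e)) has_derivative (\<lambda>s. s *\<^sub>R v)) (at 0)"
        using pderiv_vec_along_line [of Y x 0 a UNIV] diff by (simp add: v_def)
      then have 1: "(\<lambda>h. norm (Y (x + h *\<^sub>R ?e) - Y x - h *\<^sub>R v) / norm h) \<midarrow>0\<rightarrow> 0"
        by (simp add: has_derivative_at)
      have 2: "filterlim (\<lambda>n. 1 / real (Suc n)) (at 0) sequentially"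
        using LIMSEQ_inverse_real_of_nat by (intro filterlim_atI) (auto simp: inverse_eq_divide)
      have "norm (Y (x + (1 / real (Suc n)) *\<^sub>R ?e) - Y x - (1 / real (Suc n)) *\<^sub>R v) / norm (1 / real (Suc n))
          = norm (g n x - v)" for n
      proof -
        have "g n x - v = real (Suc n) *\<^sub>R (Y (x + (1 / real (Suc n)) *\<^sub>R ?e) - Y x - (1 / real (Suc n)) *\<^sub>R v)"
          by (simp add: g_def scaleR_diff_right)
        then show ?thesis by simp
      qed
      with filterlim_compose [OF 1 2] have "(\<lambda>n. g n x) \<longlonglongrightarrow> v"
        by (simp add: LIM_zero_iff tendsto_norm_zero_iff)
      then show "(\<lambda>n. g n x) \<longlonglongrightarrow> pderiv_vec a Y x" by (simp add: v_def)
    qed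
    show "AE x in lborel. norm (g n x) \<le> M' * indicator K x" for n
    proof (rule AE_I2)
      fix x
      let ?h = "1 / real (Suc n)"
      have h: "0 < ?h" "?h \<le> 1" by auto
      show "norm (g n x) \<le> M' * indicator K x"
      proof (cases "x \<in> K")
        case False
        then have "norm x > R + 1" by (simp add: K_def)
        moreover have "norm x \<le> norm (x + ?h *\<^sub>R ?e) + norm (?h *\<^sub>R ?e)"
          using norm_triangle_ineq4 [of "x + ?h *\<^sub>R ?e" "?h *\<^sub>R ?e"] by simp
        moreover have "norm (?h *\<^sub>R ?e) = ?h" by simp
        ultimately have "norm x > R" "norm (x + ?h *\<^sub>R ?e) > R" using h by linarith+
        then show ?thesis using supp False by (simp add: g_def)
      next
        case True
        have "norm (Y (x + ?h *\<^sub>R ?e) - Y (x + 0 *\<^sub>R ?e)) \<le> M' * norm (?h - 0)"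
        proof (rule differentiable_bound [where S = "{0..?h}"])
          fix t assume t: "t \<in> {0..?h}"
          show "((\<lambda>t. Y (x + t *\<^sub>R ?e)) has_derivative (\<lambda>s. s *\<^sub>R pderiv_vec a Y (x + t *\<^sub>R ?e))) (at t within {0..?h})"
            using diff by (rule pderiv_vec_along_line)
          have "t \<le> 1" using t h(2) by (metis atLeastAtMost_iff order_trans)
          then have "norm x + norm (t *\<^sub>R ?e) \<le> R + 1 + 1" using True t by (intro add_mono) (auto simp: K_def)
          then have "norm (x + t *\<^sub>R ?e) \<le> R + 2"
            using norm_triangle_ineq [of x "t *\<^sub>R ?e"] by linarith
          then have "norm (pderiv_vec a Y (x + t *\<^sub>R ?e)) \<le> M'" using M by (simp add: M'_def le_max_iff_disj)
          then show "onorm (\<lambda>s. s *\<^sub>R pderiv_vec a Y (x + t *\<^sub>R ?e)) \<le> M'"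
            by (intro onorm_bound) (auto simp: M'_def mult.commute intro: mult_left_mono)
        qed (use h in auto)
        then have "norm (Y (x + ?h *\<^sub>R ?e) - Y x) \<le> M' * ?h" by simp
        from mult_left_mono [OF this of_nat_0_le_iff [of "Suc n"]]
        have "norm (g n x) \<le> real (Suc n) * (M' * ?h)"
          unfolding g_def norm_scaleR abs_of_nat .
        then show ?thesis using True by simp
      qed
    qed
  qed (auto simp: g_def [abs_def])
  then show ?thesis by (simp add: g_int LIMSEQ_const_iff)
qed

lemma DERIV_max_0_square: "((\<lambda>t. (max 0 t)\<^sup>2) has_real_derivative 2 * max 0 t) (at t)"
proof -
  consider "t > 0" | "t < 0" | "t = 0" by linarith
  then show ?thesis
  proof cases
    case 1
    have "((\<lambda>t. t\<^sup>2) has_real_derivative 2 * max 0 t) (at t)"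
      using 1 by (auto intro!: derivative_eq_intros)
    then show ?thesis
      by (rule has_field_derivative_transform_within_open [of _ _ _ "{0<..}"]) (use 1 in auto)
  next
    case 2
    have "((\<lambda>t. 0) has_real_derivative 2 * max 0 t) (at t)"
      using 2 by (auto intro!: derivative_eq_intros)
    then show ?thesis
      by (rule has_field_derivative_transform_within_open [of _ _ _ "{..<0}"]) (use 2 in auto)
  next
    case 3
    have "(\<lambda>h. ((max 0 h)\<^sup>2) / h) \<midarrow>0\<rightarrow> (0 :: real)"
    proof (rule Lim_null_comparison)
      show "\<forall>\<^sub>F h in at 0. norm ((max 0 h)\<^sup>2 / h) \<le> \<bar>h :: real\<bar>"
        by (intro always_eventually) (auto simp: max_def power2_eq_square)
    qed (auto intro!: tendsto_eq_intros)
    then show ?thesis using 3 by (simp add: DERIV_def)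
  qed
qed

text \<open>
  The fields are multiplied by a cut-off to the ball of radius \<open>R\<close> and the compactly supported case
  is applied. The gradient of the cut-off is of order \<open>1 / R\<close> everywhere, hence integrability of the
  fields alone makes its contribution vanish in the limit. The cut-off is the square of a positive part,
  which is continuously differentiable.
\<close>

lemma integral_divergence_eq_0:
  fixes X :: "'d::finite \<Rightarrow> real ^ 'd \<Rightarrow> 'b::euclidean_space"
  assumes diff: "\<And>a x. X a differentiable (at x)"
    and cont: "\<And>a. continuous_on UNIV (pderiv_vec a (X a))"
    and int: "\<And>a. integrable lborel (X a)"
    and div: "integrable lborel (\<lambda>x. \<Sum>a\<in>UNIV. pderiv_vec a (X a) x)"
  shows "(LINT x|lborel. (\<Sum>a\<in>UNIV. pderiv_vec a (X a) x)) = 0"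
proof -
  define m where "m n x = max 0 (1 - (x \<bullet> x) / (real (Suc n))\<^sup>2)" for n and x :: "real ^ 'd"
  define c where "c n a x = - 4 * m n x * (x $ a / (real (Suc n))\<^sup>2)" for n a and x :: "real ^ 'd"
  define Y where "Y n a x = (m n x)\<^sup>2 *\<^sub>R X a x" for n a x
  have m: "0 \<le> m n x" "m n x \<le> 1" for n x
    by (auto simp: m_def)
  have m0: "m n x = 0" if "norm x > real (Suc n)" for n x
  proof -
    have "(real (Suc n))\<^sup>2 \<le> (norm x)\<^sup>2" using that by (intro power_mono) auto
    then have "1 \<le> (x \<bullet> x) / (real (Suc n))\<^sup>2" by (simp add: dot_square_norm del: of_nat_Suc)
    then show ?thesis by (simp add: m_def)
  qed
  have c: "\<bar>c n a x\<bar> \<le> 4 / real (Suc n)" for n a x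
  proof (cases "norm x > real (Suc n)")
    case False
    have "\<bar>x $ a\<bar> \<le> real (Suc n)"
      using False component_le_norm_cart [of x a] by linarith
    then have "\<bar>x $ a\<bar> / (real (Suc n))\<^sup>2 \<le> 1 / real (Suc n)"
      by (simp add: power2_eq_square divide_simps del: of_nat_Suc)
    then have "4 * m n x * (\<bar>x $ a\<bar> / (real (Suc n))\<^sup>2) \<le> 4 * 1 * (1 / real (Suc n))"
      using m [of n x] by (intro mult_mono) auto
    then show ?thesis
      using m [of n x] by (simp add: c_def abs_mult)
  qed (simp add: c_def m0)
  have dm: "((\<lambda>x. (m n x)\<^sup>2) has_derivative (\<lambda>h. - 4 * m n x * ((x \<bullet> h) / (real (Suc n))\<^sup>2))) (at x)" for n x
  proof -
    have 1: "((\<lambda>x. 1 - (x \<bullet> x) / (real (Suc n))\<^sup>2) has_derivative (\<lambda>h. - 2 * (x \<bullet> h) / (real (Suc n))\<^sup>2)) (at x)"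
      by (rule derivative_eq_intros refl ext | simp add: inner_commute add_divide_distrib)+
    from has_derivative_compose [OF this DERIV_max_0_square [unfolded has_field_derivative_def]]
    show ?thesis
      unfolding m_def by (rule has_derivative_eq_rhs) (simp add: fun_eq_iff)
  qed
  have dY: "(Y n a has_derivative (\<lambda>h. (m n x)\<^sup>2 *\<^sub>R frechet_derivative (X a) (at x) h
      + (- 4 * m n x * ((x \<bullet> h) / (real (Suc n))\<^sup>2)) *\<^sub>R X a x)) (at x)" for n a x
    unfolding Y_def [abs_def]
    using diff by (intro has_derivative_scaleR dm) (simp add: frechet_derivative_works [symmetric])
  have pY: "pderiv_vec a (Y n a) x = (m n x)\<^sup>2 *\<^sub>R pderiv_vec a (X a) x + c n a x *\<^sub>R X a x" for n a x
    by (subst pderiv_vec_eq [OF dY]) (simp add: pderiv_vec_def inner_axis c_def)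
  have Xcont: "continuous_on S (X a)" for a S
    using diff by (intro continuous_at_imp_continuous_on) (auto intro: differentiable_imp_continuous_within)
  have mcont: "continuous_on S (m n)" and ccont: "continuous_on S (c n a)" for n a S
    unfolding m_def [abs_def] c_def [abs_def] by (intro continuous_intros; simp)+
  have pYcont: "continuous_on UNIV (pderiv_vec a (Y n a))" for n a
    unfolding pY [abs_def] by (intro continuous_intros mcont ccont Xcont cont)
  have pYint: "integrable lborel (pderiv_vec a (Y n a))" for n a
  proof -
    have "integrable lborel (\<lambda>x. indicator (cball 0 (real (Suc n))) x *\<^sub>R pderiv_vec a (Y n a) x)"
      by (intro borel_integrable_compact continuous_on_subset [OF pYcont]) auto
    moreover have "indicator (cball 0 (real (Suc n))) x *\<^sub>R pderiv_vec a (Y n a) x = pderiv_vec a (Y n a) x" for x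
      using m0 [of n x] by (cases "norm x > real (Suc n)") (simp_all add: pY c_def indicator_def)
    ultimately show ?thesis by simp
  qed
  have pY0: "(LINT x|lborel. pderiv_vec a (Y n a) x) = 0" for n a
    using dY pYcont
    by (rule integral_pderiv_compact_support [where R = "real (Suc n)", OF differentiableI]) (simp add: Y_def m0)
  define T where "T n x = (\<Sum>a\<in>UNIV. pderiv_vec a (Y n a) x)" for n x
  have T0: "integral\<^sup>L lborel (T n) = 0" for n
    unfolding T_def by (simp add: Bochner_Integration.integral_sum pYint pY0)
  have Teq: "T n x = (m n x)\<^sup>2 *\<^sub>R (\<Sum>a\<in>UNIV. pderiv_vec a (X a) x) + (\<Sum>a\<in>UNIV. c n a x *\<^sub>R X a x)" for n x
    by (simp add: T_def pY sum.distrib scaleR_sum_right)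
  have "(\<lambda>n. integral\<^sup>L lborel (T n)) \<longlonglongrightarrow> (LINT x|lborel. (\<Sum>a\<in>UNIV. pderiv_vec a (X a) x))"
  proof (rule integral_dominated_convergence)
    show "integrable lborel (\<lambda>x. norm (\<Sum>a\<in>UNIV. pderiv_vec a (X a) x) + 4 * (\<Sum>a\<in>UNIV. norm (X a x)))"
      by (intro Bochner_Integration.integrable_add integrable_norm div integrable_mult_right Bochner_Integration.integrable_sum int)
    show "AE x in lborel. (\<lambda>n. T n x) \<longlonglongrightarrow> (\<Sum>a\<in>UNIV. pderiv_vec a (X a) x)"
    proof (rule AE_I2)
      fix x :: "real ^ 'd"
      have "(\<lambda>n. 4 * (1 / real (Suc n))) \<longlonglongrightarrow> 4 * 0"
        using LIMSEQ_inverse_real_of_nat by (intro tendsto_mult tendsto_const) (simp add: inverse_eq_divide)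
      then have lim: "(\<lambda>n. 4 / real (Suc n)) \<longlonglongrightarrow> 0" by simp
      have c0: "(\<lambda>n. c n a x) \<longlonglongrightarrow> 0" for a
      proof (rule Lim_null_comparison [OF _ lim])
        show "\<forall>\<^sub>F n in sequentially. norm (c n a x) \<le> 4 / real (Suc n)"
          unfolding real_norm_def by (intro always_eventually allI c)
      qed
      have "(\<lambda>n. (1 / real (Suc n))\<^sup>2) \<longlonglongrightarrow> 0\<^sup>2"
        using LIMSEQ_inverse_real_of_nat by (intro tendsto_power) (simp add: inverse_eq_divide)
      from tendsto_max [OF tendsto_const tendsto_diff [OF tendsto_const tendsto_mult [OF tendsto_const this]]]
      have "(\<lambda>n. max 0 (1 - (x \<bullet> x) * (1 / real (Suc n))\<^sup>2)) \<longlonglongrightarrow> max 0 (1 - (x \<bullet> x) * 0\<^sup>2)" .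
      then have m1: "(\<lambda>n. m n x) \<longlonglongrightarrow> 1"
        by (simp add: m_def power_divide)
      have "(\<lambda>n. T n x) \<longlonglongrightarrow> 1\<^sup>2 *\<^sub>R (\<Sum>a\<in>UNIV. pderiv_vec a (X a) x) + (\<Sum>a\<in>UNIV. 0 *\<^sub>R X a x)"
        unfolding Teq by (intro tendsto_intros m1 c0)
      then show "(\<lambda>n. T n x) \<longlonglongrightarrow> (\<Sum>a\<in>UNIV. pderiv_vec a (X a) x)" by simp
    qed
    show "AE x in lborel. norm (T n x) \<le> norm (\<Sum>a\<in>UNIV. pderiv_vec a (X a) x) + 4 * (\<Sum>a\<in>UNIV. norm (X a x))" for n
    proof (rule AE_I2)
      fix x :: "real ^ 'd"
      have "norm ((m n x)\<^sup>2 *\<^sub>R (\<Sum>a\<in>UNIV. pderiv_vec a (X a) x)) \<le> 1 * norm (\<Sum>a\<in>UNIV. pderiv_vec a (X a) x)"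
        unfolding norm_scaleR using m [of n x] by (intro mult_right_mono) (auto simp: power_le_one)
      moreover have "norm (\<Sum>a\<in>UNIV. c n a x *\<^sub>R X a x) \<le> (\<Sum>a\<in>UNIV. 4 * norm (X a x))"
      proof (rule sum_norm_le)
        fix a
        have "4 / real (Suc n) \<le> 4" by (simp add: divide_simps)
        then have "\<bar>c n a x\<bar> \<le> 4" using c [of n a x] by linarith
        then show "norm (c n a x *\<^sub>R X a x) \<le> 4 * norm (X a x)" by (simp add: mult_right_mono)
      qed
      ultimately show "norm (T n x) \<le> norm (\<Sum>a\<in>UNIV. pderiv_vec a (X a) x) + 4 * (\<Sum>a\<in>UNIV. norm (X a x))"
        unfolding Teq sum_distrib_left by (intro order_trans [OF norm_triangle_ineq]) simp
    qed
  next
    show "(\<lambda>x. \<Sum>a\<in>UNIV. pderiv_vec a (X a) x) \<in> borel_measurable lborel"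
      using div by (rule borel_measurable_integrable)
    show "T n \<in> borel_measurable lborel" for n
      unfolding T_def by (intro borel_measurable_sum borel_measurable_integrable pYint)
  qed
  then show ?thesis by (simp add: T0 LIMSEQ_const_iff)
qed

section \<open>Orthogonality of eigenspinors\<close>

lemma sphere_integral_eq: "sphere_integral k f = (LINT x|lborel. conf x ^ CARD('d) *\<^sub>R f x)"
  for f :: "real ^ 'd::finite \<Rightarrow> 'b::{banach, second_countable_topology}"
  unfolding sphere_integral_def sqrt_det_round_metric ..

lemma smoothD:
  assumes "smooth f"
  shows "continuous_on S f" "f differentiable (at x)" "continuous_on S (pderiv_vec i f)"
proof -
  have "C_k 0 f" "C_k (Suc 0) f" using assms unfolding smooth_def by blast+
  then show "continuous_on S f" "f differentiable (at x)" "continuous_on S (pderiv_vec i f)"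
    by (auto intro: continuous_on_subset)
qed

lemma transition_transition:
  assumes "x \<noteq> 0"
  shows "transition k x \<noteq> 0" "transition k (transition k x) = x" "norm (transition k x) = 1 / norm x"
proof -
  have r: "reflect k (c *\<^sub>R reflect k v) = c *\<^sub>R v" for v :: "real ^ 'a" and c
    by (simp add: reflect_def vec_eq_iff)
  have s: "transition k x \<bullet> transition k x = 1 / (x \<bullet> x)"
    using assms by (simp add: transition_def reflect_reflect_inner)
  then show "transition k x \<noteq> 0" "norm (transition k x) = 1 / norm x"
    using assms by (auto simp: norm_eq_sqrt_inner real_sqrt_divide)
  show "transition k (transition k x) = x"
    using assms by (subst transition_def) (simp add: s, simp add: transition_def r)
qed

text \<open>
  The transition map carries the exterior of the unit ball of one chart into the unit ball of the
  other, and the change of frame is an isometry.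
\<close>

lemma smooth_spinor_bounded:
  assumes \<gamma>: "gamma_matrices \<gamma>" and u: "u \<in> smooth_spinors \<gamma> k"
  shows "\<exists>B. \<forall>x. norm (u North x) \<le> B"
proof -
  have "bounded (u c ` cball 0 1)" for c
    using u by (intro compact_imp_bounded compact_continuous_image smoothD)
      (cases c; auto simp: smooth_spinors_def)+
  then obtain B where B: "\<And>c x. norm x \<le> 1 \<Longrightarrow> norm (u c x) \<le> B c"
    unfolding bounded_iff by (metis (no_types) imageI mem_cball_0)
  have "norm (u North x) \<le> max (B North) (B South)" for x
  proof (cases "norm x \<le> 1")
    case False
    then have x: "x \<noteq> 0" by auto
    have "norm (u South (transition k x)) = norm (u North x)"
      using u x by (simp add: smooth_spinors_def matrix_vector_mul_assoc [symmetric] norm_gamma [OF \<gamma>]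
          norm_clifford [OF \<gamma>] norm_sgn)
    moreover have "norm (transition k x) \<le> 1"
      using False x by (simp add: transition_transition divide_le_eq_1)
    ultimately show ?thesis using B [of "transition k x" South] by simp
  qed (use B in \<open>simp add: le_max_iff_disj\<close>)
  then show ?thesis by blast
qed

lemma continuous_AE_eq_0:
  fixes f :: "'a::euclidean_space \<Rightarrow> 'b::real_normed_vector"
  assumes f: "continuous_on UNIV f" and AE: "AE x in lborel. f x = 0"
  shows "f x = 0"
proof (rule ccontr)
  assume x: "f x \<noteq> 0"
  define S where "S = {x. f x \<noteq> 0}"
  have "open S"
    unfolding S_def by (intro open_Collect_neq f continuous_on_const)
  moreover have "S \<in> null_sets lborel"
  proof (subst AE_iff_null_sets)
    show "S \<in> sets lborel" using \<open>open S\<close> by simp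
    show "AE x in lborel. x \<notin> S" using AE by (simp add: S_def)
  qed
  then have "negligible S"
    unfolding negligible_iff_null_sets by (rule null_sets_completionI)
  ultimately show False
    using open_not_negligible [of S] x by (auto simp: S_def)
qed

lemma smooth_spinor_eqI:
  assumes u: "u \<in> smooth_spinors \<gamma> k" and v: "v \<in> smooth_spinors \<gamma> k"
    and AE: "AE x in lborel. u North x = v North x"
  shows "u = v"
proof (intro ext)
  fix c x
  have sm: "smooth (u c)" "smooth (v c)" for c
    using u v by (cases c; simp add: smooth_spinors_def)+
  have N: "u North x = v North x" for x
  proof -
    have "u North x - v North x = 0"
    proof (rule continuous_AE_eq_0 [where f = "\<lambda>x. u North x - v North x"])
      show "AE x in lborel. u North x - v North x = 0" using AE by simp
    qed (intro continuous_on_diff smoothD(1) sm)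
    then show ?thesis by simp
  qed
  have S: "u South y = v South y" if y: "y \<noteq> 0" for y
  proof -
    have tr: "w South y = (\<gamma> k ** clifford \<gamma> (sgn (transition k y))) *v w North (transition k y)"
      if "w \<in> smooth_spinors \<gamma> k" for w
      using that transition_transition [OF y, of k] by (auto simp: smooth_spinors_def)
    show ?thesis unfolding tr [OF u] tr [OF v] N ..
  qed
  have "u South x - v South x = 0"
  proof (rule continuous_AE_eq_0 [where f = "\<lambda>x. u South x - v South x"])
    show "AE x in lborel. u South x - v South x = 0"
      by (rule AE_I' [of "{0}"]) (use S in \<open>auto simp: null_sets_def\<close>)
  qed (intro continuous_on_diff smoothD(1) sm)
  then show "u c x = v c x" using N by (cases c) auto
qed

lemma integrable_conf_bounded:
  fixes f :: "real ^ 'd::finite \<Rightarrow> 'b::{banach, second_countable_topology}"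
  assumes d: "CARD('d) \<ge> 3" and m: "m \<ge> CARD('d) - 1"
    and f: "f \<in> borel_measurable borel" "\<And>x. norm (f x) \<le> B"
  shows "integrable lborel (\<lambda>x. conf x ^ m *\<^sub>R f x)"
proof (rule Bochner_Integration.integrable_bound)
  have "integrable lborel (\<lambda>x :: real ^ 'd. conf x ^ m)"
    by (rule integrable_conf_power [of "CARD('d) - 1"]) (use d m in simp_all)
  then show "integrable lborel (\<lambda>x :: real ^ 'd. B * conf x ^ m)"
    by (intro integrable_mult_right)
  have "norm (conf x ^ m *\<^sub>R f x) \<le> norm (B * conf x ^ m)" for x
  proof -
    have "conf x ^ m * norm (f x) \<le> conf x ^ m * B"
      using f(2) [of x] conf_pos [of x] by (intro mult_left_mono) (auto simp: less_imp_le)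
    also have "\<dots> \<le> norm (B * conf x ^ m)" by (simp add: mult.commute)
    finally show ?thesis using conf_pos [of x] by (simp add: abs_of_pos)
  qed
  then show "AE x in lborel. norm (conf x ^ m *\<^sub>R f x) \<le> norm (B * conf x ^ m)" by simp
  show "(\<lambda>x. conf x ^ m *\<^sub>R f x) \<in> borel_measurable lborel"
    using f(1) by measurable
qed

lemma spinor_inner_eq:
  fixes u v :: "('d::finite, 'n::finite) spinor"
  shows "spinor_inner k u v = (LINT x|lborel. conf x ^ CARD('d) *\<^sub>R cinner (u North x) (v North x))"
  unfolding spinor_inner_def sphere_integral_eq cinner_def ..

lemma integrable_conf_cinner:
  fixes \<gamma> :: "'d::finite \<Rightarrow> complex ^ 'n ^ 'n::finite"
  assumes \<gamma>: "gamma_matrices \<gamma>" and d: "CARD('d) \<ge> 3" and m: "m \<ge> CARD('d) - 1"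
    and u: "u \<in> smooth_spinors \<gamma> k" and v: "v \<in> smooth_spinors \<gamma> k"
  shows "integrable lborel (\<lambda>x. conf x ^ m *\<^sub>R cinner (u North x) (v North x))"
    and "integrable lborel (\<lambda>x. conf x ^ m *\<^sub>R cinner (u North x) (\<gamma> a *v v North x))"
proof -
  obtain B C where B: "\<And>x. norm (u North x) \<le> B" and C: "\<And>x. norm (v North x) \<le> C"
    using smooth_spinor_bounded [OF \<gamma> u] smooth_spinor_bounded [OF \<gamma> v] by blast
  have cont: "continuous_on UNIV (u North)" "continuous_on UNIV (v North)"
    using u v by (auto simp: smooth_spinors_def intro: smoothD)
  have *: "integrable lborel (\<lambda>x. conf x ^ m *\<^sub>R cinner (u North x) (w x))"
    if w: "continuous_on UNIV w" "\<And>x. norm (w x) \<le> C" for w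
  proof (rule integrable_conf_bounded [OF d m])
    show "(\<lambda>x. cinner (u North x) (w x)) \<in> borel_measurable borel"
      by (intro borel_measurable_continuous_onI cinner.continuous_on cont w)
    show "norm (cinner (u North x) (w x)) \<le> B * C * real CARD('n)" for x
    proof -
      have "norm (u North x) * norm (w x) \<le> B * C"
        using order_trans [OF norm_ge_zero B] by (intro mult_mono B w(2) norm_ge_zero)
      from order_trans [OF norm_cinner_le mult_right_mono [OF this of_nat_0_le_iff]]
      show ?thesis .
    qed
  qed
  show "integrable lborel (\<lambda>x. conf x ^ m *\<^sub>R cinner (u North x) (v North x))"
    by (rule *) (use cont C in auto)
  show "integrable lborel (\<lambda>x. conf x ^ m *\<^sub>R cinner (u North x) (\<gamma> a *v v North x))"
  proof (rule *)
    show "continuous_on UNIV (\<lambda>x. \<gamma> a *v v North x)"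
      using cont(2) by (rule bounded_linear.continuous_on [OF matrix_vector_mul_bounded_linear])
  qed (simp add: norm_gamma [OF \<gamma>] C)
qed

text \<open>
  The vector field with components \<open>conf ^ (d - 1)\<close> times \<open>cinner u (\<gamma> a *v v)\<close> has divergence
  \<open>\<i> * (l' - l) * conf ^ d * cinner u v\<close>. The power \<open>d - 1\<close> is the one for which the derivative of
  the conformal factor cancels the zeroth-order terms of the two Dirac equations.
\<close>

lemma eigenspinors_orthogonal:
  fixes \<gamma> :: "'d::finite \<Rightarrow> complex ^ 'n ^ 'n::finite"
  assumes \<gamma>: "gamma_matrices \<gamma>" and d: "CARD('d) \<ge> 3"
    and u: "u \<in> eigenspinors \<gamma> k l" and v: "v \<in> eigenspinors \<gamma> k l'" and l: "l \<noteq> l'"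
  shows "spinor_inner k u v = 0"
proof -
  define D where "D = CARD('d) - 1"
  have cD: "CARD('d) = Suc D" using d by (simp add: D_def)
  define f g where "f = u North" and "g = v North"
  have us: "u \<in> smooth_spinors \<gamma> k" "v \<in> smooth_spinors \<gamma> k"
    using u v by (simp_all add: eigenspinors_def)
  then have sm: "smooth f" "smooth g" by (simp_all add: smooth_spinors_def f_def g_def)
  define X where "X a x = conf x ^ D *\<^sub>R cinner (f x) (\<gamma> a *v g x)" for a x
  define f' g' where "f' a x = pderiv_vec a f x" and "g' a x = pderiv_vec a g x" for a x
  have dX: "(X a has_derivative (\<lambda>h. conf x ^ D *\<^sub>R (cinner (f x) (\<gamma> a *v frechet_derivative g (at x) h)
        + cinner (frechet_derivative f (at x) h) (\<gamma> a *v g x))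
      + (real D * (- (conf x)\<^sup>2 * (x \<bullet> h)) * conf x ^ (D - 1)) *\<^sub>R cinner (f x) (\<gamma> a *v g x))) (at x)" for a x
    unfolding X_def [abs_def]
    by (intro has_derivative_scaleR has_derivative_power conf_has_derivative cinner.FDERIV
        bounded_linear.has_derivative [OF matrix_vector_mul_bounded_linear] frechet_derivative_works [THEN iffD1] smoothD sm)
  have pX: "pderiv_vec a (X a) x = conf x ^ D *\<^sub>R (cinner (f x) (\<gamma> a *v g' a x) + cinner (f' a x) (\<gamma> a *v g x))
      - (real D * conf x ^ Suc D * x $ a) *\<^sub>R cinner (f x) (\<gamma> a *v g x)" for a x
  proof -
    have "real D * ((conf x)\<^sup>2 * x $ a) * conf x ^ (D - 1) = real D * conf x ^ Suc D * x $ a"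
      by (cases D) (simp_all add: power2_eq_square)
    then show ?thesis
      by (subst pderiv_vec_eq [OF dX]) (simp add: f'_def g'_def pderiv_vec_def inner_axis)
  qed
  have mv: "continuous_on UNIV (\<lambda>x. \<gamma> a *v w x)" if "continuous_on UNIV w" for a and w :: "real ^ 'd \<Rightarrow> _"
    using that by (rule bounded_linear.continuous_on [OF matrix_vector_mul_bounded_linear])
  have cont: "continuous_on UNIV (pderiv_vec a (X a))" for a
    unfolding pX [abs_def] f'_def g'_def
    by (intro continuous_intros cinner.continuous_on mv smoothD sm)
  have G: "(\<Sum>a\<in>UNIV. \<gamma> a *v pderiv_vec a w x) = conf x *\<^sub>R ((\<i> * complex_of_real r) *s w x + (real D / 2) *\<^sub>R (clifford \<gamma> x *v w x))"
    if w: "y \<in> eigenspinors \<gamma> k r" "w = y North" for y w r x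
  proof -
    define s where "s = (\<Sum>a\<in>UNIV. \<gamma> a *v pderiv_vec a w x)"
    have "dirac \<gamma> k y North x = complex_of_real r *s w x"
      using w by (simp add: eigenspinors_def)
    then have "(- \<i>) *s ((1 / conf x) *\<^sub>R s - (real D / 2) *\<^sub>R (clifford \<gamma> x *v w x)) = complex_of_real r *s w x"
      by (simp add: dirac_eq [OF \<gamma>] s_def w(2) cD)
    from arg_cong [OF this, of "\<lambda>z. \<i> *s z"]
    have "(1 / conf x) *\<^sub>R s - (real D / 2) *\<^sub>R (clifford \<gamma> x *v w x) = (\<i> * complex_of_real r) *s w x"
      by (simp add: vector_smult_assoc)
    then have "(1 / conf x) *\<^sub>R s = (\<i> * complex_of_real r) *s w x + (real D / 2) *\<^sub>R (clifford \<gamma> x *v w x)"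
      by (simp add: algebra_simps)
    from arg_cong [OF this, of "\<lambda>z. conf x *\<^sub>R z"]
    show ?thesis by (simp add: s_def)
  qed
  have div: "(\<Sum>a\<in>UNIV. pderiv_vec a (X a) x) = (\<i> * complex_of_real (l' - l)) * (conf x ^ CARD('d) *\<^sub>R cinner (f x) (g x))" for x
  proof -
    have 1: "(\<Sum>a\<in>UNIV. cinner (f x) (\<gamma> a *v g' a x)) = cinner (f x) (\<Sum>a\<in>UNIV. \<gamma> a *v pderiv_vec a g x)"
      by (simp add: cinner.sum_right g'_def)
    have 2: "(\<Sum>a\<in>UNIV. cinner (f' a x) (\<gamma> a *v g x)) = cinner (\<Sum>a\<in>UNIV. \<gamma> a *v pderiv_vec a f x) (g x)"
      by (simp add: cinner.sum_left f'_def cinner_gamma [OF \<gamma>])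
    have 3: "(\<Sum>a\<in>UNIV. (real D * conf x ^ Suc D * x $ a) *\<^sub>R cinner (f x) (\<gamma> a *v g x))
        = (real D * conf x ^ Suc D) *\<^sub>R cinner (f x) (clifford \<gamma> x *v g x)"
      by (simp add: clifford_apply cinner.sum_right cinner.scaleR_right scaleR_sum_right)
    have "(\<Sum>a\<in>UNIV. pderiv_vec a (X a) x) = conf x ^ D *\<^sub>R (cinner (f x) (\<Sum>a\<in>UNIV. \<gamma> a *v pderiv_vec a g x)
        + cinner (\<Sum>a\<in>UNIV. \<gamma> a *v pderiv_vec a f x) (g x))
        - (real D * conf x ^ Suc D) *\<^sub>R cinner (f x) (clifford \<gamma> x *v g x)"
      unfolding pX sum_subtractf scaleR_sum_right [symmetric] sum.distrib 1 2 3 ..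
    also have "\<dots> = (\<i> * complex_of_real (l' - l)) * (conf x ^ CARD('d) *\<^sub>R cinner (f x) (g x))"
      unfolding G [OF u f_def] G [OF v g_def] cD
      by (simp add: cinner.add_left cinner.add_right cinner.scaleR_left cinner.scaleR_right cinner_scale
          cinner_clifford [OF \<gamma>] scaleR_conv_of_real [where 'a = complex] algebra_simps)
    finally show ?thesis .
  qed
  have "(LINT x|lborel. (\<Sum>a\<in>UNIV. pderiv_vec a (X a) x)) = 0"
  proof (rule integral_divergence_eq_0)
    show "X a differentiable (at x)" for a x using dX by (auto simp: differentiable_def)
    show "integrable lborel (X a)" for a
      unfolding X_def [abs_def] f_def g_def using integrable_conf_cinner(2) [OF \<gamma> d _ us, of D] by (simp add: D_def)
    show "integrable lborel (\<lambda>x. \<Sum>a\<in>UNIV. pderiv_vec a (X a) x)"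
      unfolding div f_def g_def using integrable_conf_cinner(1) [OF \<gamma> d _ us, of "CARD('d)"]
      by (intro integrable_mult_right) simp
  qed (rule cont)
  then have "(\<i> * complex_of_real (l' - l)) * spinor_inner k u v = 0"
    unfolding div spinor_inner_eq f_def [symmetric] g_def [symmetric] by (simp only: integral_mult_right_zero)
  then show ?thesis using l by simp
qed

section \<open>The functional calculus on an eigenspinor\<close>

lemma spinor_inner_diff:
  fixes \<gamma> :: "'d::finite \<Rightarrow> complex ^ 'n ^ 'n::finite"
  assumes \<gamma>: "gamma_matrices \<gamma>" and d: "CARD('d) \<ge> 3"
    and "w \<in> smooth_spinors \<gamma> k" "u \<in> smooth_spinors \<gamma> k" "v \<in> smooth_spinors \<gamma> k"
  shows "spinor_inner k w (\<lambda>c x. u c x - v c x) = spinor_inner k w u - spinor_inner k w v"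
proof -
  have "integrable lborel (\<lambda>x. conf x ^ CARD('d) *\<^sub>R cinner (w North x) (u North x))"
    "integrable lborel (\<lambda>x. conf x ^ CARD('d) *\<^sub>R cinner (w North x) (v North x))"
    using assms by (intro integrable_conf_cinner(1) [OF \<gamma> d]; simp)+
  then show ?thesis
    unfolding spinor_inner_eq cinner.diff_right scaleR_diff_right by (rule Bochner_Integration.integral_diff)
qed

lemma smooth_spinor_eqI_L2:
  fixes \<gamma> :: "'d::finite \<Rightarrow> complex ^ 'n ^ 'n::finite"
  assumes \<gamma>: "gamma_matrices \<gamma>" and d: "CARD('d) \<ge> 3"
    and u: "u \<in> smooth_spinors \<gamma> k" and v: "v \<in> smooth_spinors \<gamma> k"
    and 0: "(LINT x|lborel. conf x ^ CARD('d) * (norm (u North x - v North x))\<^sup>2) = 0"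
  shows "u = v"
proof (rule smooth_spinor_eqI [OF u v])
  obtain B C where B: "\<And>x. norm (u North x) \<le> B" and C: "\<And>x. norm (v North x) \<le> C"
    using smooth_spinor_bounded [OF \<gamma> u] smooth_spinor_bounded [OF \<gamma> v] by blast
  have "continuous_on UNIV (u North)" "continuous_on UNIV (v North)"
    using u v by (auto simp: smooth_spinors_def intro: smoothD)
  then have meas: "(\<lambda>x. (norm (u North x - v North x))\<^sup>2) \<in> borel_measurable borel"
    by (intro borel_measurable_continuous_onI continuous_intros)
  have "norm ((norm (u North x - v North x))\<^sup>2) \<le> (B + C)\<^sup>2" for x
  proof -
    have "norm (u North x - v North x) \<le> B + C"
      using norm_triangle_ineq4 [of "u North x" "v North x"] B [of x] C [of x] by linarith
    then show ?thesis by (simp add: power_mono)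
  qed
  from integrable_conf_bounded [OF d _ meas this, of "CARD('d)"]
  have int: "integrable lborel (\<lambda>x. conf x ^ CARD('d) * (norm (u North x - v North x))\<^sup>2)"
    by simp
  have "AE x in lborel. conf x ^ CARD('d) * (norm (u North x - v North x))\<^sup>2 = 0"
    using 0 by (subst (asm) integral_nonneg_eq_0_iff_AE [OF int]) (auto simp: less_imp_le)
  then show "AE x in lborel. u North x = v North x" by simp
qed

lemma zero_eigenspinor:
  fixes \<gamma> :: "'d::finite \<Rightarrow> complex ^ 'n ^ 'n::finite"
  assumes "gamma_matrices \<gamma>"
  shows "(\<lambda>c x. 0) \<in> eigenspinors \<gamma> k l"
proof -
  have "smooth (\<lambda>x :: real ^ 'd. 0 :: complex ^ 'n)" by (intro elementary_smooth elementary_const)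
  moreover have "pderiv_vec a (\<lambda>x. 0 :: complex ^ 'n) x = 0" for a :: 'd and x
    by (subst pderiv_vec_eq [OF has_derivative_const]) simp
  ultimately show ?thesis
    by (simp add: eigenspinors_def smooth_spinors_def fun_eq_iff dirac_eq [OF assms])
qed

text \<open>
  The projection of \<open>u\<close> to another eigenspace is zero by orthogonality. Two candidates for a
  projection have the same products with all elements of the eigenspace, in particular with each
  other, and therefore coincide.
\<close>

lemma eigenprojection_eigenspinor:
  fixes \<gamma> :: "'d::finite \<Rightarrow> complex ^ 'n ^ 'n::finite"
  assumes \<gamma>: "gamma_matrices \<gamma>" and d: "CARD('d) \<ge> 3" and u: "u \<in> eigenspinors \<gamma> k l"
  shows "eigenprojection \<gamma> k l' u = (if l' = l then u else (\<lambda>c x. 0))"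
proof -
  define v where "v = (if l' = l then u else (\<lambda>c x. 0))"
  have sm: "w \<in> smooth_spinors \<gamma> k" if "w \<in> eigenspinors \<gamma> k r" for w r
    using that by (simp add: eigenspinors_def)
  have v: "v \<in> eigenspinors \<gamma> k l'"
    using u zero_eigenspinor [OF \<gamma>] by (simp add: v_def)
  have orth: "spinor_inner k w (\<lambda>c x. u c x - v c x) = 0" if w: "w \<in> eigenspinors \<gamma> k l'" for w
  proof (cases "l' = l")
    case True
    then show ?thesis by (simp add: v_def spinor_inner_eq cinner.zero_right)
  next
    case False
    then show ?thesis
      using eigenspinors_orthogonal [OF \<gamma> d w u] by (simp add: v_def)
  qed
  show ?thesis
    unfolding eigenprojection_def v_def [symmetric]
  proof (rule the_equality)
    fix w assume "w \<in> eigenspinors \<gamma> k l' \<and> (\<forall>y\<in>eigenspinors \<gamma> k l'. spinor_inner k y (\<lambda>c x. u c x - w c x) = 0)"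
    then have w: "w \<in> eigenspinors \<gamma> k l'"
      and wo: "\<And>y. y \<in> eigenspinors \<gamma> k l' \<Longrightarrow> spinor_inner k y (\<lambda>c x. u c x - w c x) = 0" by auto
    have eq: "spinor_inner k y w = spinor_inner k y v" if y: "y \<in> eigenspinors \<gamma> k l'" for y
      using wo [OF y] orth [OF y] spinor_inner_diff [OF \<gamma> d sm [OF y] sm [OF u] sm [OF w]]
        spinor_inner_diff [OF \<gamma> d sm [OF y] sm [OF u] sm [OF v]] by simp
    have i: "integrable lborel (\<lambda>x. conf x ^ CARD('d) *\<^sub>R cinner (y North x) (z North x))"
      if "y \<in> eigenspinors \<gamma> k l'" "z \<in> eigenspinors \<gamma> k l'" for y z
      using integrable_conf_cinner(1) [OF \<gamma> d _ sm [OF that(1)] sm [OF that(2)], of "CARD('d)"] by simp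
    have "complex_of_real (LINT x|lborel. conf x ^ CARD('d) * (norm (w North x - v North x))\<^sup>2)
      = (LINT x|lborel. conf x ^ CARD('d) *\<^sub>R cinner (w North x - v North x) (w North x - v North x))"
      by (simp add: integral_complex_of_real [symmetric] cinner_self scaleR_conv_of_real [where 'a = complex])
    also have "\<dots> = (spinor_inner k w w - spinor_inner k w v) - (spinor_inner k v w - spinor_inner k v v)"
      unfolding spinor_inner_eq cinner.diff_right cinner.diff_left scaleR_diff_right
      by (simp add: Bochner_Integration.integral_diff i w v)
    also have "\<dots> = 0" by (simp add: eq w v)
    finally show "w = v"
      by (intro smooth_spinor_eqI_L2 [OF \<gamma> d sm [OF w] sm [OF v]]) (simp only: of_real_eq_0_iff)
  qed (use v orth in blast)
qed

lemma Lp_norm_eq: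
  fixes u :: "('d::finite, 'n::finite) spinor"
  shows "Lp_norm k r u = (LINT x|lborel. conf x ^ CARD('d) * norm (u North x) powr r) powr (1 / r)"
  by (simp add: Lp_norm_def sphere_integral_eq)

text \<open>
  As soon as a finite set of frequencies contains \<open>l\<close>, the partial sum of the spectral series equals
  \<open>F l *s u\<close>. The norms in the defining limit are therefore eventually constant.
\<close>

lemma dirac_calculus_eigenspinor:
  fixes \<gamma> :: "'d::finite \<Rightarrow> complex ^ 'n ^ 'n::finite"
  assumes \<gamma>: "gamma_matrices \<gamma>" and d: "CARD('d) \<ge> 3" and u: "u \<in> eigenspinors \<gamma> k l"
    and Fu: "(\<lambda>c x. F l *s u c x) \<in> smooth_spinors \<gamma> k"
  shows "dirac_calculus \<gamma> k F u = (\<lambda>c x. F l *s u c x)"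
proof -
  define v where "v = (\<lambda>c x. F l *s u c x)"
  have part: "(\<Sum>r\<in>A. F r *s eigenprojection \<gamma> k r u c x) = v c x" if "finite A" "l \<in> A" for A c x
  proof -
    have "(\<Sum>r\<in>A. F r *s eigenprojection \<gamma> k r u c x) = (\<Sum>r\<in>A. if r = l then F l *s u c x else 0)"
      by (intro sum.cong refl) (simp add: eigenprojection_eigenspinor [OF \<gamma> d u])
    then show ?thesis using that by (simp add: v_def)
  qed
  have lim: "((\<lambda>A. Lp_norm k 2 (\<lambda>c x. w c x - (\<Sum>r\<in>A. F r *s eigenprojection \<gamma> k r u c x))) \<longlongrightarrow> 0)
      (finite_subsets_at_top UNIV) \<longleftrightarrow> Lp_norm k 2 (\<lambda>c x. w c x - v c x) = 0" for w :: "('d, 'n) spinor"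
  proof -
    have "\<forall>\<^sub>F A in finite_subsets_at_top UNIV.
        Lp_norm k 2 (\<lambda>c x. w c x - (\<Sum>r\<in>A. F r *s eigenprojection \<gamma> k r u c x)) = Lp_norm k 2 (\<lambda>c x. w c x - v c x)"
      unfolding eventually_finite_subsets_at_top
      by (intro exI [of _ "{l}"]) (auto simp: part)
    then have "((\<lambda>A. Lp_norm k 2 (\<lambda>c x. w c x - (\<Sum>r\<in>A. F r *s eigenprojection \<gamma> k r u c x))) \<longlongrightarrow> 0)
      (finite_subsets_at_top UNIV) \<longleftrightarrow> ((\<lambda>A. Lp_norm k 2 (\<lambda>c x. w c x - v c x)) \<longlongrightarrow> 0) (finite_subsets_at_top (UNIV :: real set))"
      by (rule tendsto_cong)
    then show ?thesis by (simp add: tendsto_const_iff)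
  qed
  have v: "v \<in> smooth_spinors \<gamma> k" using Fu by (simp add: v_def)
  show ?thesis
    unfolding dirac_calculus_def lim v_def [symmetric]
  proof (rule the_equality)
    show "v \<in> smooth_spinors \<gamma> k \<and> Lp_norm k 2 (\<lambda>c x. v c x - v c x) = 0"
      using v by (simp add: Lp_norm_eq)
    fix w assume w: "w \<in> smooth_spinors \<gamma> k \<and> Lp_norm k 2 (\<lambda>c x. w c x - v c x) = 0"
    then have "(LINT x|lborel. conf x ^ CARD('d) * (norm (w North x - v North x))\<^sup>2) = 0"
      by (simp add: Lp_norm_eq)
    then show "w = v"
      using w v by (intro smooth_spinor_eqI_L2 [OF \<gamma> d]) auto
  qed
qed

lemma norm_smult: "norm (c *s w) = norm c * norm w" for w :: "complex ^ 'n::finite"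
  by (simp add: norm_vec_def L2_set_def norm_mult power_mult_distrib real_sqrt_mult flip: sum_distrib_left)

lemma dirac_calculus_zonal:
  fixes \<gamma> :: "'d::finite \<Rightarrow> complex ^ 'n ^ 'n::finite"
  assumes \<gamma>: "gamma_matrices \<gamma>" and d: "CARD('d) \<ge> 3" and p: "zonal_profile (real CARD('d) / 2) l p"
  shows "dirac_calculus \<gamma> k F (zonal_spinor \<gamma> k p v) = (\<lambda>c x. F l *s zonal_spinor \<gamma> k p v c x)"
proof (rule dirac_calculus_eigenspinor [OF \<gamma> d zonal_spinor_eigenspinor [OF \<gamma> p]])
  show "(\<lambda>c x. F l *s zonal_spinor \<gamma> k p v c x) \<in> smooth_spinors \<gamma> k"
    unfolding zonal_spinor_scale [symmetric] by (rule zonal_spinor_smooth [OF \<gamma>])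
qed

lemma Lp_norm_scale:
  fixes u :: "('d::finite, 'n::finite) spinor"
  assumes "r > 0"
  shows "Lp_norm k r (\<lambda>c x. a *s u c x) = norm a * Lp_norm k r u"
proof -
  have *: "conf x ^ CARD('d) * norm (a *s u North x) powr r = norm a powr r * (conf x ^ CARD('d) * norm (u North x) powr r)" for x
    by (simp add: norm_smult powr_mult mult_ac)
  have "0 \<le> (LINT x|lborel. conf x ^ CARD('d) * norm (u North x) powr r)"
    by (intro integral_nonneg_AE) (simp add: less_imp_le)
  then show ?thesis
    using assms unfolding Lp_norm_eq * integral_mult_right_zero by (simp add: powr_mult powr_powr)
qed

section \<open>Norms of zonal eigenspinors\<close>

lemma zonal_L2_upper:
  fixes \<gamma> :: "'d::finite \<Rightarrow> complex ^ 'n ^ 'n::finite"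
  assumes \<gamma>: "gamma_matrices \<gamma>" and D: "CARD('d) = Suc D" "D \<ge> 2"
    and p: "zonal_profile ((real D + 1) / 2) l p" "poly p 1 = 1" and l: "real D \<le> l" and v: "norm v = 1"
  shows "(LINT x|lborel. conf x ^ CARD('d) * (norm (zonal_field \<gamma> p v (x :: real ^ 'd)))\<^sup>2)
    \<le> 9 * 2 ^ D * (D / l) ^ D * (LINT x|lborel. conf x / norm (x :: real ^ 'd) ^ D)"
proof -
  define M where "M = 9 * 2 ^ D * (D / l) ^ D"
  have l0: "l > 0" using D l by linarith
  have pt: "conf x ^ CARD('d) * (norm (zonal_field \<gamma> p v x))\<^sup>2 \<le> M * (conf x / norm x ^ D)" if x: "x \<noteq> 0" for x :: "real ^ 'd"
  proof -
    have n: "norm x > 0" using x by simp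
    have c: "conf x * norm x > 0" using n by simp
    have "(height x)\<^sup>2 < 1" using height_eq(3) [of x] c by (smt (verit) zero_less_power)
    then have h: "\<bar>height x\<bar> < 1" by (simp add: abs_square_less_1)
    have "((conf x * norm x)\<^sup>2) powr (real D / 2) = (conf x * norm x) ^ D"
    proof -
      have "(conf x * norm x)\<^sup>2 = (conf x * norm x) powr 2" using c by simp
      then show ?thesis using c by (simp only: powr_powr) (simp add: powr_realpow)
    qed
    then have "(conf x * norm x) ^ D * zonal_energy p (height x) \<le> 2 * M"
      using zonal_energy_decay [OF p(1) _ l h] D p(2) by (simp add: height_eq(3) M_def)
    then have 1: "conf x * ((conf x * norm x) ^ D * (zonal_energy p (height x) / 2)) \<le> conf x * M"
      by (intro mult_left_mono) (auto simp: less_imp_le)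
    have "conf x ^ CARD('d) * (norm (zonal_field \<gamma> p v x))\<^sup>2 * norm x ^ D
        = conf x * ((conf x * norm x) ^ D * (zonal_energy p (height x) / 2))"
      by (simp add: norm_zonal_field [OF \<gamma>] v D power_mult_distrib)
    also note 1
    also have "conf x * M = M * conf x" by simp
    finally have "conf x ^ CARD('d) * (norm (zonal_field \<gamma> p v x))\<^sup>2 * norm x ^ D \<le> M * conf x" .
    then show ?thesis
      using n by (simp add: pos_le_divide_eq)
  qed
  have int: "integrable lborel (\<lambda>x :: real ^ 'd. M * (conf x / norm x ^ D))"
    using D by (intro integrable_mult_right integrable_conf_weight) auto
  have "(LINT x|lborel. conf x ^ CARD('d) * (norm (zonal_field \<gamma> p v (x :: real ^ 'd)))\<^sup>2)
      \<le> (LINT x|lborel. M * (conf x / norm (x :: real ^ 'd) ^ D))"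
  proof (rule integral_mono_AE' [OF int])
    show "AE x :: real ^ 'd in lborel. conf x ^ CARD('d) * (norm (zonal_field \<gamma> p v x))\<^sup>2 \<le> M * (conf x / norm x ^ D)"
      by (rule AE_I' [of "{0}"]) (use pt in \<open>auto simp: null_sets_def\<close>)
    show "AE x :: real ^ 'd in lborel. 0 \<le> M * (conf x / norm x ^ D)"
      using l0 by (auto simp: M_def less_imp_le)
  qed
  then show ?thesis by (simp only: integral_mult_right_zero M_def)
qed

text \<open>Only the contribution of the ball of radius comparable to \<open>1 / l\<close> around the pole is kept.\<close>

lemma zonal_Lq_lower:
  fixes \<gamma> :: "'d::finite \<Rightarrow> complex ^ 'n ^ 'n::finite"
  assumes \<gamma>: "gamma_matrices \<gamma>" and D: "CARD('d) = Suc D" "D \<ge> 2"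
    and p: "zonal_profile ((real D + 1) / 2) l p" "poly p 1 = 1" and l: "real D \<le> l" and v: "norm v = 1"
    and q: "q > 0"
  shows "(LINT x|lborel. conf x ^ CARD('d) * norm (zonal_field \<gamma> p v (x :: real ^ 'd)) powr q)
    \<ge> (1 / 4) powr q * (unit_ball_vol (real CARD('d)) * (1 / (l * 2 ^ (D + 5))) ^ CARD('d))"
proof -
  define r where "r = 1 / (l * 2 ^ (D + 5))"
  have l0: "l > 0" using D l by linarith
  have l1: "1 \<le> l" using D l by linarith
  have r: "0 < r" using l0 by (simp add: r_def)
  have "1 * 1 \<le> l * 2 ^ (D + 5)" using l1 by (intro mult_mono one_le_power) auto
  then have r1: "r \<le> 1" by (simp add: r_def)
  have pt: "conf x ^ CARD('d) * norm (zonal_field \<gamma> p v x) powr q \<ge> (1 / 4) powr q" if x: "norm x \<le> r" for x :: "real ^ 'd"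
  proof -
    have s: "x \<bullet> x \<le> r\<^sup>2" using x by (simp add: dot_square_norm power_mono)
    also have "r\<^sup>2 \<le> 1" using r r1 by (simp add: power_le_one)
    finally have s1: "x \<bullet> x \<le> 1" .
    have c1: "1 \<le> conf x" using s1 by (simp add: conf_def pos_le_divide_eq)
    have h: "0 \<le> height x" "height x \<le> 1" using c1 conf_bounds(1) [of x] by (simp_all add: height_eq(1))
    have "sqrt (1 - height x) \<le> 2 * r"
    proof -
      have "1 - height x \<le> 2 * r\<^sup>2"
        unfolding height_eq(2) using s conf_bounds(1) [of x] by (intro mult_mono) auto
      also have "\<dots> \<le> (2 * r)\<^sup>2" using r by (simp add: power2_eq_square)
      finally show ?thesis using r by (intro real_le_lsqrt) (auto simp: less_imp_le)
    qed
    then have "l * 2 ^ (D + 3) * sqrt (1 - height x) \<le> l * 2 ^ (D + 3) * (2 * r)"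
      using l0 by (intro mult_left_mono) auto
    also have "\<dots> = 1 / 2" using l0 by (simp add: r_def power_add)
    finally have "1 / 2 \<le> poly p (height x)"
      using zonal_profile_near_pole [OF p _ h] l D by simp
    then have "(1 / 2)\<^sup>2 \<le> (poly p (height x))\<^sup>2" by (intro power_mono) auto
    then have "1 * (1 / 2)\<^sup>2 \<le> (1 + height x) * (poly p (height x))\<^sup>2"
      using h by (intro mult_mono) auto
    also have "\<dots> \<le> zonal_energy p (height x)"
      using h by (simp add: zonal_energy_def)
    finally have "(1 / 4)\<^sup>2 \<le> (norm (zonal_field \<gamma> p v x))\<^sup>2"
      unfolding norm_zonal_field [OF \<gamma>] v by (simp add: power2_eq_square)
    then have "1 / 4 \<le> norm (zonal_field \<gamma> p v x)" by (rule power2_le_imp_le) simp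
    then have "(1 / 4) powr q \<le> norm (zonal_field \<gamma> p v x) powr q"
      using q by (intro powr_mono2) auto
    moreover have "1 \<le> conf x ^ CARD('d)" using c1 by (rule one_le_power)
    ultimately show ?thesis
      using mult_mono [of 1 "conf x ^ CARD('d)" "(1 / 4) powr q" "norm (zonal_field \<gamma> p v x) powr q"] by simp
  qed
  have sm: "zonal_spinor \<gamma> k p v \<in> smooth_spinors \<gamma> k" for k
    by (rule zonal_spinor_smooth [OF \<gamma>])
  have cont: "continuous_on UNIV (zonal_field \<gamma> p v)"
    by (rule smoothD(1) [OF smooth_zonal_field])
  obtain B where B: "\<And>x. norm (zonal_field \<gamma> p v x) \<le> B"
    using smooth_spinor_bounded [OF \<gamma> sm] by auto
  have int: "integrable lborel (\<lambda>x :: real ^ 'd. conf x ^ CARD('d) *\<^sub>R norm (zonal_field \<gamma> p v x) powr q)"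
  proof (rule integrable_conf_bounded)
    have [measurable]: "zonal_field \<gamma> p v \<in> borel_measurable borel"
      by (rule borel_measurable_continuous_onI [OF cont])
    show "(\<lambda>x. norm (zonal_field \<gamma> p v x) powr q) \<in> borel_measurable borel" by measurable
    show "norm (norm (zonal_field \<gamma> p v x) powr q) \<le> B powr q" for x
      using B q by (simp add: powr_mono2)
  qed (use D in auto)
  have "(1 / 4) powr q * (unit_ball_vol (real CARD('d)) * r ^ CARD('d))
      = (LINT x|lborel. (1 / 4) powr q * indicator (cball (0 :: real ^ 'd) r) x)"
    using r by (simp add: content_cball)
  also have "\<dots> \<le> (LINT x|lborel. conf x ^ CARD('d) * norm (zonal_field \<gamma> p v x) powr q)"
  proof (rule integral_mono')
    show "integrable lborel (\<lambda>x :: real ^ 'd. conf x ^ CARD('d) * norm (zonal_field \<gamma> p v x) powr q)"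
      using int by simp
    show "(1 / 4) powr q * indicator (cball 0 r) x \<le> conf x ^ CARD('d) * norm (zonal_field \<gamma> p v x) powr q" for x :: "real ^ 'd"
      using pt [of x] by (cases "x \<in> cball 0 r") (simp_all add: less_imp_le)
    show "0 \<le> conf x ^ CARD('d) * norm (zonal_field \<gamma> p v x) powr q" for x :: "real ^ 'd"
      by (simp add: less_imp_le)
  qed
  finally show ?thesis by (simp add: r_def)
qed

section \<open>Sharpness\<close>

text \<open>
  For \<open>l = 2 * j + d / 2\<close> the supposed estimate bounds a positive constant by a multiple of
  \<open>l powr e\<close>, where \<open>e\<close> is the difference of \<open>s\<close> and the critical exponent.
\<close>

theorem mainTheorem3:
  fixes \<gamma> :: "'d::finite \<Rightarrow> complex ^ 'n ^ 'n::finite"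
    and k :: 'd
    and d q :: real
  assumes "CARD('d) \<ge> 4"
    and "d = real CARD('d)"
    and "CARD('n) = 2 ^ (CARD('d) div 2)"
    and "gamma_matrices \<gamma>"
    and "q = 2 * (d - 1) / (d - 3)"
  shows "strichartz_exponent d 2 q = (d + 1) / (2 * (d - 1)) \<and>
    (\<forall>I s. is_interval I \<longrightarrow> bounded I \<longrightarrow> measure lborel I > 0 \<longrightarrow>
       s < (d + 1) / (2 * (d - 1)) \<longrightarrow>
       \<not> (\<exists>C. \<forall>u\<in>smooth_spinors \<gamma> k.
              LpLq_norm k 2 q I (\<lambda>t. dirac_propagator \<gamma> k t u) \<le> C * sobolev_norm \<gamma> k s u))"
proof (intro conjI allI impI notI)
  note \<gamma> = \<open>gamma_matrices \<gamma>\<close>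
  have d4: "d \<ge> 4" using assms(1,2) by simp
  show exponent: "strichartz_exponent d 2 q = (d + 1) / (2 * (d - 1))"
    using d4 unfolding strichartz_exponent_def assms(5) by (simp add: field_simps)
  have d3: "CARD('d) \<ge> 3" using assms(1) by simp
  have q: "q > 0" using d4 by (simp add: assms(5))
  fix I :: "real set" and s :: real
  assume I: "is_interval I" "bounded I" "measure lborel I > 0" and s: "s < (d + 1) / (2 * (d - 1))"
  assume "\<exists>C. \<forall>u\<in>smooth_spinors \<gamma> k.
              LpLq_norm k 2 q I (\<lambda>t. dirac_propagator \<gamma> k t u) \<le> C * sobolev_norm \<gamma> k s u"
  then obtain C where C: "\<And>u. u \<in> smooth_spinors \<gamma> k \<Longrightarrow>
      LpLq_norm k 2 q I (\<lambda>t. dirac_propagator \<gamma> k t u) \<le> C * sobolev_norm \<gamma> k s u" by blast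
  define D where "D = CARD('d) - 1"
  have D: "CARD('d) = Suc D" "D \<ge> 2" using assms(1) by (simp_all add: D_def)
  have dD: "d = real D + 1" using D assms(2) by simp
  define J where "J = (LINT x|lborel. conf x / norm (x :: real ^ 'd) ^ D)"
  define K1 where "K1 = ((1 / 4) powr q * unit_ball_vol d * (1 / 2 ^ (D + 5)) powr d) powr (1 / q)"
  define K2 where "K2 = (9 * 2 ^ D * real D powr D * J) powr (1 / 2)"
  define e where "e = s - D / 2 + d / q"
  have J0: "J \<ge> 0" unfolding J_def by (intro integral_nonneg_AE) (simp add: less_imp_le)
  have V: "unit_ball_vol (real D + 1) > 0" by simp
  have "K1 > 0" by (simp add: K1_def dD less_imp_neq [OF V, symmetric])
  have Lp0: "0 \<le> Lp_norm k r w" for r and w :: "('d, 'n) spinor"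
    by (simp add: Lp_norm_eq)
  have K20: "0 \<le> K2" by (simp add: K2_def)
  have e: "e < 0"
  proof -
    have "D / 2 - d / q = (d + 1) / (2 * (d - 1))"
    proof -
      have "d * (1 / 2 - 1 / q) = d / 2 - d / q" by (simp add: right_diff_distrib)
      moreover have "D / 2 = d / 2 - 1 / 2" using dD by (simp add: field_simps)
      ultimately show ?thesis using exponent unfolding strichartz_exponent_def by linarith
    qed
    then show ?thesis using s by (simp add: e_def)
  qed
  \<comment> \<open>The eigenvalues of the zonal eigenspinors constructed from profiles of even degree.\<close>
  define L where "L j = real (2 * j) + (real D + 1) / 2" for j
  have main: "measure lborel I powr (1 / 2) * K1 \<le> \<bar>C\<bar> * 2 powr (\<bar>s\<bar> / 2) * K2 * L j powr e" if j: "j \<ge> D" for j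
  proof -
    define l where "l = L j"
    have l: "real D \<le> l" "1 \<le> l"
    proof -
      have "real D \<le> real (2 * j)" "2 \<le> real D"
        using j D(2) by (simp_all del: of_nat_mult)
      moreover have "1 \<le> (real D + 1) / 2"
        using D(2) by simp
      moreover have "l = real (2 * j) + (real D + 1) / 2"
        by (simp add: l_def L_def)
      ultimately show "real D \<le> l" "1 \<le> l" by linarith+
    qed
    obtain p where p: "zonal_profile ((real D + 1) / 2) l p" "poly p 1 = 1"
      using zonal_profile_normalized [of "2 * j" D] by (auto simp: l_def L_def)
    then have p': "zonal_profile (real CARD('d) / 2) l p" by (simp add: D(1) add.commute)
    define v :: "complex ^ 'n" where "v = axis undefined 1"
    have v: "norm v = 1" by (simp add: v_def)
    define u where "u = zonal_spinor \<gamma> k p v"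
    have u: "u \<in> smooth_spinors \<gamma> k" unfolding u_def by (rule zonal_spinor_smooth [OF \<gamma>])
    have "Lp_norm k q (dirac_propagator \<gamma> k t u) = Lp_norm k q u" for t
      unfolding dirac_propagator_def u_def dirac_calculus_zonal [OF \<gamma> d3 p'] Lp_norm_scale [OF q]
      by simp
    then have "LpLq_norm k 2 q I (\<lambda>t. dirac_propagator \<gamma> k t u) = measure lborel I powr (1 / 2) * Lp_norm k q u"
      by (simp add: LpLq_norm_def set_lebesgue_integral_def powr_mult powr_powr Lp_norm_eq)
    moreover have "sobolev_norm \<gamma> k s u = (1 + l\<^sup>2) powr (s / 2) * Lp_norm k 2 u"
      unfolding sobolev_norm_def u_def dirac_calculus_zonal [OF \<gamma> d3 p'] by (subst Lp_norm_scale) simp_all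
    ultimately have "measure lborel I powr (1 / 2) * Lp_norm k q u \<le> C * ((1 + l\<^sup>2) powr (s / 2) * Lp_norm k 2 u)"
      using C [OF u] by simp
    also have "\<dots> \<le> \<bar>C\<bar> * ((2 powr (\<bar>s\<bar> / 2) * l powr s) * (K2 * l powr (- D / 2)))"
    proof (intro mult_mono)
      show "(1 + l\<^sup>2) powr (s / 2) \<le> 2 powr (\<bar>s\<bar> / 2) * l powr s"
      proof -
        have l2: "l powr s = (l\<^sup>2) powr (s / 2)"
        proof -
          have "l\<^sup>2 = l powr 2" using l by simp
          then show ?thesis by (simp only: powr_powr) simp
        qed
        show ?thesis
        proof (cases "s \<ge> 0")
          case True
          have "1 \<le> l\<^sup>2" using l by (simp add: one_le_power)
          then have "(1 + l\<^sup>2) powr (s / 2) \<le> (2 * l\<^sup>2) powr (s / 2)"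
            using True by (intro powr_mono2) auto
          then show ?thesis using True by (simp add: powr_mult l2)
        next
          case False
          have "(1 + l\<^sup>2) powr (s / 2) \<le> 1 * (l\<^sup>2) powr (s / 2)"
            using False l by (simp add: powr_mono2')
          also have "\<dots> \<le> 2 powr (\<bar>s\<bar> / 2) * (l\<^sup>2) powr (s / 2)"
            by (intro mult_right_mono ge_one_powr_ge_zero) auto
          finally show ?thesis by (simp add: l2)
        qed
      qed
      show "Lp_norm k 2 u \<le> K2 * l powr (- D / 2)"
      proof -
        have "(D / l) ^ D = real D powr D * l powr (- D)"
          using l D by (simp add: powr_realpow powr_minus divide_inverse power_mult_distrib power_inverse)
        then have "(LINT x|lborel. conf x ^ CARD('d) * (norm (u North x))\<^sup>2) \<le> (9 * 2 ^ D * real D powr D * J) * l powr (- D)"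
          using zonal_L2_upper [OF \<gamma> D p l(1) v] by (simp add: u_def J_def mult_ac)
        then have "Lp_norm k 2 u \<le> ((9 * 2 ^ D * real D powr D * J) * l powr (- D)) powr (1 / 2)"
          unfolding Lp_norm_eq by (intro powr_mono2 integral_nonneg_AE) (auto simp: less_imp_le)
        also have "\<dots> = K2 * l powr (- D / 2)"
          using J0 by (simp add: K2_def powr_mult powr_powr)
        finally show ?thesis .
      qed
    qed (simp_all add: Lp0 K20)
    also have "\<dots> = \<bar>C\<bar> * 2 powr (\<bar>s\<bar> / 2) * K2 * l powr (s - D / 2)"
    proof -
      have "l powr (s - D / 2) = l powr s * l powr (- D / 2)"
        using powr_add [of l s "- D / 2"] by simp
      then show ?thesis by (simp only: mult_ac)
    qed
    finally have upper: "measure lborel I powr (1 / 2) * Lp_norm k q u \<le> \<bar>C\<bar> * 2 powr (\<bar>s\<bar> / 2) * K2 * l powr (s - D / 2)" .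
    have "K1 * l powr (- d / q) \<le> Lp_norm k q u"
    proof -
      define B where "B = (1 / 4) powr q * (unit_ball_vol d * (1 / (l * 2 ^ (D + 5))) ^ CARD('d))"
      have "(1 / (l * 2 ^ (D + 5))) ^ CARD('d) = (1 / 2 ^ (D + 5)) powr d * l powr (- d)"
        using l unfolding assms(2) by (simp add: powr_realpow powr_minus divide_inverse power_mult_distrib power_inverse mult_ac)
      then have "B powr (1 / q) = K1 * l powr (- d / q)"
        by (simp add: B_def K1_def powr_mult powr_powr mult_ac dD)
      moreover have "B powr (1 / q) \<le> Lp_norm k q u"
        unfolding Lp_norm_eq
      proof (rule powr_mono2)
        show "B \<le> (LINT x|lborel. conf x ^ CARD('d) * norm (u North x) powr q)"
          using zonal_Lq_lower [OF \<gamma> D p l(1) v q] by (simp add: B_def u_def assms(2))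
      qed (use q l in \<open>auto simp: B_def dD\<close>)
      ultimately show ?thesis by simp
    qed
    then have "measure lborel I powr (1 / 2) * (K1 * l powr (- d / q)) \<le> measure lborel I powr (1 / 2) * Lp_norm k q u"
      by (intro mult_left_mono) auto
    with upper have "measure lborel I powr (1 / 2) * K1 * l powr (- d / q) \<le> \<bar>C\<bar> * 2 powr (\<bar>s\<bar> / 2) * K2 * l powr (s - D / 2)"
      by simp
    from mult_right_mono [OF this, of "l powr (d / q)"]
    have "measure lborel I powr (1 / 2) * K1 * (l powr (- d / q) * l powr (d / q))
        \<le> \<bar>C\<bar> * 2 powr (\<bar>s\<bar> / 2) * K2 * (l powr (s - D / 2) * l powr (d / q))"
      by (simp only: mult.assoc powr_ge_zero)
    also have "l powr (- d / q) * l powr (d / q) = 1"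
      using l by (simp flip: powr_add)
    also have "l powr (s - D / 2) * l powr (d / q) = L j powr e"
      by (simp add: e_def l_def flip: powr_add)
    finally show ?thesis by simp
  qed
  have "filterlim L at_top sequentially"
  proof (rule filterlim_at_top_mono [OF filterlim_real_sequentially])
    have "real j \<le> L j" for j
    proof -
      have "0 \<le> (real D + 1) / 2" "real j \<le> real (2 * j)" by simp_all
      then show ?thesis unfolding L_def by linarith
    qed
    then show "\<forall>\<^sub>F j in sequentially. real j \<le> L j" by simp
  qed
  then have "(\<lambda>j. \<bar>C\<bar> * 2 powr (\<bar>s\<bar> / 2) * K2 * L j powr e) \<longlonglongrightarrow> \<bar>C\<bar> * 2 powr (\<bar>s\<bar> / 2) * K2 * 0"
    using e by (intro tendsto_mult tendsto_const tendsto_neg_powr)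
  then have "measure lborel I powr (1 / 2) * K1 \<le> 0"
    using main by (intro LIMSEQ_le_const [where X = "\<lambda>j. \<bar>C\<bar> * 2 powr (\<bar>s\<bar> / 2) * K2 * L j powr e"]) auto
  then show False
    using I(3) \<open>K1 > 0\<close> by (simp add: mult_le_0_iff)
qed

end
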